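(* Let $R$ be a finite group of squarefree order. If $R$ is not abelian and $R$ is not isomorphic to any of $\mathrm{D}_6$, $\mathrm{D}_{10}$, $\mathrm{D}_{30}$, $\mathrm{D}_6\times\mathrm{C}_q$, $\mathrm{D}_{10}\times \mathrm{C}_q$, or $\mathrm{C}_q\rtimes\mathrm{C}_p$ (for primes $p,q$), then $R$ is not GRR-detecting.
   Context: $\mathrm{C}_n$ is the cyclic group of order $n$, $\mathrm{D}_{2n}$ the dihedral group of order $2n$. For a group $R$ and $S\subseteq R$, the Cayley digraph $\mathrm{Cay}(R,S)$ has vertex set $R$ and an arc from $r$ to $sr$ whenever $s\in S$. It is a GRR if $S=S^{-1}$ and $\mathrm{Aut}(\mathrm{Cay}(R,S))$ equals the right regular representation $\hat R$. $\mathrm{Aut}(R)_S$ is the group of automorphisms of $R$ fixing $S$ setwise. $R$ is GRR-detecting if for every $S\subseteq R$ with $S=S^{-1}$, $\mathrm{Aut}(R)_S=1$ implies $\mathrm{Cay}(R,S)$ is a GRR. *)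

theory Defs
  imports "HOL-Algebra.Algebra" "HOL-Computational_Algebra.Squarefree"
begin

abbreviation cyclic_group :: "nat \<Rightarrow> int monoid" where
  "cyclic_group n \<equiv> integer_mod_group n"

text \<open>Dihedral group of order 2n: elements (a,e) stand for r^a s^e with r^n = s^2 = 1, s r s = r^-1.\<close>
definition dihedral_group :: "nat \<Rightarrow> (int \<times> int) monoid" where
  "dihedral_group n = \<lparr> carrier = {0..<int n} \<times> {0..<2},
     monoid.mult = (\<lambda>(a,e) (b,f). ((a + (if e = 0 then b else - b)) mod int n, (e + f) mod 2)),
     one = (0, 0) \<rparr>"

definition is_semidirect_Cq_Cp :: "('a, 'b) monoid_scheme \<Rightarrow> nat \<Rightarrow> nat \<Rightarrow> bool" where
  "is_semidirect_Cq_Cp R q p \<longleftrightarrow>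
     (\<exists>N H. N \<lhd> R \<and> subgroup H R \<and> N \<inter> H = {\<one>\<^bsub>R\<^esub>} \<and> N <#>\<^bsub>R\<^esub> H = carrier R
        \<and> R\<lparr>carrier := N\<rparr> \<cong> cyclic_group q \<and> R\<lparr>carrier := H\<rparr> \<cong> cyclic_group p)"

definition cay_arc :: "('a, 'b) monoid_scheme \<Rightarrow> 'a set \<Rightarrow> 'a \<Rightarrow> 'a \<Rightarrow> bool" where
  "cay_arc R S x y \<longleftrightarrow> x \<in> carrier R \<and> y \<in> carrier R \<and> (\<exists>s\<in>S. y = s \<otimes>\<^bsub>R\<^esub> x)"

definition cay_aut :: "('a, 'b) monoid_scheme \<Rightarrow> 'a set \<Rightarrow> ('a \<Rightarrow> 'a) set" where
  "cay_aut R S = {f. bij_betw f (carrier R) (carrier R) \<and>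
     (\<forall>x\<in>carrier R. \<forall>y\<in>carrier R. cay_arc R S (f x) (f y) \<longleftrightarrow> cay_arc R S x y)}"

definition inv_set :: "('a, 'b) monoid_scheme \<Rightarrow> 'a set \<Rightarrow> 'a set" where
  "inv_set R S = (\<lambda>s. inv\<^bsub>R\<^esub> s) ` S"

text \<open>GRR: S = S^-1 and every automorphism of Cay(R,S) is (on the vertex set) a right
  multiplication x \<mapsto> x g, i.e. Aut(Cay(R,S)) equals the right regular representation.\<close>
definition is_GRR :: "('a, 'b) monoid_scheme \<Rightarrow> 'a set \<Rightarrow> bool" where
  "is_GRR R S \<longleftrightarrow> S = inv_set R S \<and>
     (\<forall>f\<in>cay_aut R S. \<exists>g\<in>carrier R. \<forall>x\<in>carrier R. f x = x \<otimes>\<^bsub>R\<^esub> g)"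

definition aut_stab_trivial :: "('a, 'b) monoid_scheme \<Rightarrow> 'a set \<Rightarrow> bool" where
  "aut_stab_trivial R S \<longleftrightarrow>
     (\<forall>\<phi>\<in>iso R R. \<phi> ` S = S \<longrightarrow> (\<forall>x\<in>carrier R. \<phi> x = x))"

definition GRR_detecting :: "('a, 'b) monoid_scheme \<Rightarrow> bool" where
  "GRR_detecting R \<longleftrightarrow>
     (\<forall>S. S \<subseteq> carrier R \<longrightarrow> S = inv_set R S \<longrightarrow> aut_stab_trivial R S \<longrightarrow> is_GRR R S)"

end

theory Submission
  imports Defs "HOL-Number_Theory.Cong"
begin

text \<open>
  A group of squarefree order has a normal Sylow subgroup for its largest prime: if d divides the
  order n and every prime of d exceeds every prime of n/d, then x^d = 1 has exactly d solutions, by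
  descending induction on d. Induction over quotients then presents the group by generators a, b, c of
  pairwise coprime orders m, k, z with c central and b acting on a by a power l of exact order k
  modulo m with l - 1 a unit, so that every automorphism has the form a to a^u, b to a^v b, c to c^w.

  If N and H are subgroups with 1 < N <= H < R, N normal in R, and the part of S outside H is a union
  of cosets of N, then right multiplication by a nontrivial element of N on H, extended by the
  identity, is an automorphism of Cay(R, S) that is not regular. It remains to choose S so that no
  (u, v, w) other than (1, 0, 1) preserves it. An inverse pair inside the cyclic group generated by a
  and c forces u and w to be 1 or -1, and the set {0, 1, 3} of exponents in a coset of that cyclic
  group excludes the reflections as soon as the modulus is at least 6. The excluded groups are those
  for which the moduli are too small, or in which there is no room for N and H.
\<close>

section \<open>Counting elements of prescribed order\<close>

text \<open>Why \<open>l - 1\<close> must be a unit: \<open>a^(l-1)\<close> is the commutator of b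
  and a, so <a> is the commutator subgroup and <c> the centre. Both are characteristic, and this is
  what makes automorphisms so few. The obstacle is that S must be coarse (a union of N-cosets off H)
  and yet rigid. There are three ways to have both. A nontrivial centre gives N inside <c> and H =
  <a, c>. A composite m = n * q gives N = <a^n> and H = <a^n, b>, with the rigid part of S inside H.
  A composite k = k1 * k2 gives N = <a> and H = <a, b^k2>, with all of S inside H. If m and k are
  prime and z = 1, none of them is available: this is the excluded semidirect product. The bound 6
  comes from {0, 1, 3} being invariant under x -> 1 - x modulo 5. As m is odd, the small moduli are
  3 and 5. The units there have order dividing 4, so a squarefree k > 1 is 2 and the action is
  inversion; hence the dihedral groups in the list. The modulus 15 is the only composite squarefree
  odd one whose factors are all below 6.\<close>

lemma prime_dvd_card_nonfixed_points:
  assumes "finite W" and fX: "f ` W \<subseteq> W" and per: "\<And>x. x \<in> W \<Longrightarrow> (f ^^ r) x = x"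
    and r: "Factorial_Ring.prime (r::nat)"
  shows "r dvd card {x \<in> W. f x \<noteq> x}"
proof -
  define Y where "Y = {x \<in> W. f x \<noteq> x}"
  define O' where "O' x = range (\<lambda>i. (f ^^ i) x)" for x
  have r0: "r > 0" using r by (simp add: prime_gt_0_nat)
  have iterX: "(f ^^ i) x \<in> W" if "x \<in> W" for i x
    using that fX by (induction i) auto
  have modr: "(f ^^ (i mod r)) x = (f ^^ i) x" if "x \<in> W" for i x
    using funpow_mod_eq[OF per[OF that]] by simp
  have fY: "(f ^^ i) x \<in> Y" if "x \<in> Y" for i x
  proof (rule ccontr)
    \<comment> \<open>Once \<open>f^i x\<close> is a fixed point, the iterates are constant from
      index i on. The indices \<open>i * r\<close> and \<open>i * r + 1\<close> are both at least i
      and give x and f x.\<close>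
    assume "(f ^^ i) x \<notin> Y"
    with that iterX have fxi: "f ((f ^^ i) x) = (f ^^ i) x" by (auto simp: Y_def)
    have x: "x \<in> W" using that Y_def by auto
    have "(f ^^ (j + i)) x = (f ^^ i) x" for j
      by (induction j) (auto simp: fxi)
    then have eq: "(f ^^ j) x = (f ^^ i) x" if "j \<ge> i" for j
      by (metis le_add_diff_inverse2 that)
    have "(f ^^ (i * r)) x = x" using modr[OF x, of "i * r"] by simp
    moreover have "(f ^^ (i * r + 1)) x = f x" using calculation by simp
    moreover have "i * r \<ge> i" using r0 by simp
    moreover from this have "i \<le> i * r + 1" by linarith
    ultimately have "f x = x" using eq[of "i * r"] eq[of "i * r + 1"] by metis
    then show False using that Y_def by auto
  qed
  have O_eq: "O' x = (\<lambda>i. (f ^^ i) x) ` {..<r}" if "x \<in> W" for x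
  proof -
    have "(f ^^ i) x \<in> (\<lambda>i. (f ^^ i) x) ` {..<r}" for i
      using modr[OF that, of i, symmetric] r0 by auto
    then show ?thesis by (auto simp: O'_def)
  qed
  have cardO: "card (O' x) = r" if x: "x \<in> Y" for x
  proof -
    have xW: "x \<in> W" and ne: "f x \<noteq> x" using x by (auto simp: Y_def)
    \<comment> \<open>A repetition yields a period d with 0 < d < r. As d is invertible modulo the
      prime r, a multiple of d is 1 modulo r, which makes x a fixed point.\<close>
    have "False" if "i < j" "j < r" "(f ^^ i) x = (f ^^ j) x" for i j
    proof -
      define d where "d = j - i"
      have "(f ^^ (r - i + i)) x = (f ^^ (r - i)) ((f ^^ j) x)"
        using that by (simp only: funpow_add o_apply)
      also have "\<dots> = (f ^^ (r - i + j)) x" by (simp only: funpow_add o_apply)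
      also have "r - i + j = d + r" using that d_def by auto
      finally have "(f ^^ d) x = x" using that per[OF xW] by (simp add: funpow_add)
      then have dn: "(f ^^ (d * u)) x = x" for u
        by (induction u) (auto simp: funpow_add)
      have "coprime d r" using that r d_def
        by (metis coprime_commute diff_less diff_is_0_eq gr_implies_not0 less_imp_diff_less nat_dvd_not_less
             not_le prime_imp_coprime zero_less_diff)
      then obtain u where "[d * u = 1] (mod r)" using cong_solve_coprime_nat[of d r] by (auto simp: One_nat_def)
      then have "d * u mod r = 1" using prime_gt_1_nat[OF r] by (simp add: cong_def)
      then have "f x = x" using dn[of u] modr[OF xW, of "d * u"] by simp
      then show False using ne by simp
    qed
    then have "inj_on (\<lambda>i. (f ^^ i) x) {..<r}"
      by (metis (no_types, lifting) inj_onI lessThan_iff linorder_neqE_nat)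
    then show ?thesis using O_eq[OF xW] by (simp add: card_image)
  qed
  have O_sub: "O' z \<subseteq> O' x" if "z \<in> O' x" for x z
    using that by (auto simp: O'_def) (metis comp_apply funpow_add rangeI)
  have O_eqI: "O' z = O' x" if "z \<in> O' x" "x \<in> W" for x z
  proof
    obtain i where i: "z = (f ^^ i) x" "i < r" using \<open>z \<in> O' x\<close> unfolding O_eq[OF \<open>x \<in> W\<close>] by auto
    have "(f ^^ (r - i + i)) x = (f ^^ (r - i)) z" unfolding i(1) funpow_add by simp
    then have "x = (f ^^ (r - i)) z" using per[OF that(2)] i(2) by simp
    then have "x \<in> O' z" by (auto simp: O'_def)
    then show "O' x \<subseteq> O' z" by (rule O_sub)
  qed (rule O_sub[OF that(1)])
  have un: "\<Union>(O' ` Y) = Y"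
  proof
    show "\<Union>(O' ` Y) \<subseteq> Y" using fY by (auto simp: O'_def)
    have "x \<in> O' x" for x unfolding O'_def by (rule range_eqI[of _ _ 0]) simp
    then show "Y \<subseteq> \<Union>(O' ` Y)" by auto
  qed
  have "r dvd card (\<Union>(O' ` Y))"
  proof (rule dvd_partition)
    show "finite (\<Union>(O' ` Y))" using un \<open>finite W\<close> by (simp add: Y_def)
    show "\<forall>c\<in>O' ` Y. r dvd card c" using cardO by auto
    show "\<forall>c1\<in>O' ` Y. \<forall>c2\<in>O' ` Y. c1 \<noteq> c2 \<longrightarrow> c1 \<inter> c2 = {}"
    proof (intro ballI impI)
      fix c1 c2 assume "c1 \<in> O' ` Y" "c2 \<in> O' ` Y" "c1 \<noteq> c2"
      then obtain x y where "x \<in> Y" "y \<in> Y" "c1 = O' x" "c2 = O' y" by auto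
      then show "c1 \<inter> c2 = {}" using O_eqI \<open>c1 \<noteq> c2\<close> Y_def by blast
    qed
  qed
  then show ?thesis using un Y_def by simp
qed


text \<open>In general not a subgroup, so Lagrange's theorem says nothing about it; its size is the
  subject of Frobenius's theorem on the equation x^e = 1.\<close>

definition torsion :: "('a, 'b) monoid_scheme \<Rightarrow> nat \<Rightarrow> 'a set" where
  "torsion G e = {x \<in> carrier G. x [^]\<^bsub>G\<^esub> e = \<one>\<^bsub>G\<^esub>}"

context group
begin

text \<open>Cauchy's theorem, read off from Sylow's existence theorem for the exponent 1.\<close>

lemma exists_elem_prime_ord:
  assumes fin: "finite (carrier G)" and p: "Factorial_Ring.prime p" and dvd: "p dvd order G"
  obtains t where "t \<in> carrier G" "ord t = p"
proof -
  have "order G = p ^ 1 * (order G div p)" using dvd by simp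
  then obtain H where H: "subgroup H G" "card H = p"
    using sylow_thm[OF p is_group _ fin] by (metis power_one_right)
  have "H \<noteq> {\<one>}" using H(2) p not_prime_1 by fastforce
  then obtain t where t: "t \<in> H" "t \<noteq> \<one>" using subgroup.one_closed[OF H(1)] by blast
  interpret H: group "G\<lparr>carrier := H\<rparr>" using subgroup.subgroup_is_group[OF H(1)] is_group by blast
  have "t [^]\<^bsub>G\<lparr>carrier := H\<rparr>\<^esub> p = \<one>"
    using H.pow_order_eq_1[of t] t(1) H(2) by (simp add: order_def)
  then have "t [^] p = \<one>" by (simp add: nat_pow_def)
  moreover have tG: "t \<in> carrier G" using t(1) subgroup.mem_carrier[OF H(1)] by blast
  ultimately have "ord t dvd p" using pow_eq_id by blast
  moreover have "ord t \<noteq> 1" using t(2) tG ord_eq_1 by blast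
  ultimately have "ord t = p" using p by (meson prime_nat_iff)
  with tG show ?thesis by (rule that)
qed

lemma conj_nat_pow:
  assumes "t \<in> carrier G" "y \<in> carrier G"
  shows "(t \<otimes> y \<otimes> inv t) [^] (n::nat) = t \<otimes> y [^] n \<otimes> inv t"
proof (induction n)
  case (Suc n)
  have "(t \<otimes> y [^] n \<otimes> inv t) \<otimes> (t \<otimes> y \<otimes> inv t) = t \<otimes> y [^] n \<otimes> (inv t \<otimes> t) \<otimes> y \<otimes> inv t"
    using assms by (simp only: m_assoc m_closed inv_closed nat_pow_closed)
  then show ?case using Suc assms by (simp add: m_assoc)
qed (use assms in auto)

text \<open>Let t have order r. Conjugation by t permutes the solutions of x^e = 1, and the points
  it moves are divisible by r in number. The points it fixes commute with t; since t^e = 1, left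
  multiplication by t maps them to each other without fixed points, so their number is divisible by
  r as well.\<close>

lemma prime_dvd_card_torsion:
  assumes fin: "finite (carrier G)" and r: "Factorial_Ring.prime r" and dvd: "r dvd e" "r dvd order G"
  shows "r dvd card (torsion G e)"
proof -
  obtain t where t: "t \<in> carrier G" "ord t = r"
    using exists_elem_prime_ord[OF fin r dvd(2)] .
  have finT: "finite (torsion G e)" using fin by (simp add: torsion_def)
  define f where "f y = t \<otimes> y \<otimes> inv t" for y
  have f: "f y \<in> torsion G e" if "y \<in> torsion G e" for y
    using that t(1) by (auto simp: torsion_def f_def conj_nat_pow)
  have fp: "(f ^^ i) y = t [^] i \<otimes> y \<otimes> inv (t [^] i)" if "y \<in> carrier G" for i y
  proof (induction i)
    case (Suc i)
    have "t [^] Suc i = t \<otimes> t [^] i" by (rule nat_pow_Suc2[OF t(1)])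
    then show ?case using Suc that t(1) by (simp add: f_def m_assoc inv_mult_group del: nat_pow_Suc)
  qed (use that in simp)
  have "t [^] r = \<one>" using t pow_ord_eq_1 by blast
  then have "(f ^^ r) y = y" if "y \<in> torsion G e" for y
    using fp[of y r] that by (simp add: torsion_def)
  then have 1: "r dvd card {y \<in> torsion G e. f y \<noteq> y}"
    using prime_dvd_card_nonfixed_points[OF finT _ _ r, of f] f by blast
  define C where "C = {y \<in> torsion G e. f y = y}"
  have comm: "t \<otimes> y = y \<otimes> t" if "y \<in> C" for y
  proof -
    have "y \<in> carrier G" "t \<otimes> y \<otimes> inv t = y" using that by (auto simp: C_def f_def torsion_def)
    then show ?thesis using t(1) by (metis inv_solve_right m_closed)
  qed
  have CG: "C \<subseteq> carrier G" by (auto simp: C_def torsion_def)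
  have te: "t [^] e = \<one>" using t dvd(1) pow_eq_id by blast
  have 2: "(\<lambda>y. t \<otimes> y) ` C \<subseteq> C"
  proof clarify
    fix y assume y: "y \<in> C"
    have yG: "y \<in> carrier G" using y CG by blast
    have "(t \<otimes> y) [^] e = t [^] e \<otimes> y [^] e"
      using pow_mult_distrib[OF comm[OF y] t(1) yG] .
    then have "(t \<otimes> y) [^] e = \<one>" using te y by (simp add: C_def torsion_def)
    moreover have "f (t \<otimes> y) = t \<otimes> y"
      using comm[OF y] t(1) yG by (simp add: f_def m_assoc)
    ultimately show "t \<otimes> y \<in> C" using t(1) yG by (simp add: C_def torsion_def)
  qed
  have tp: "((\<otimes>) t ^^ i) y = t [^] i \<otimes> y" if "y \<in> carrier G" for i y
  proof (induction i)
    case (Suc i)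
    have "t [^] Suc i = t \<otimes> t [^] i" by (rule nat_pow_Suc2[OF t(1)])
    then show ?case using Suc that t(1) by (simp add: m_assoc del: nat_pow_Suc)
  qed (use that in simp)
  have "t \<noteq> \<one>" using t r by force
  then have ne: "t \<otimes> y \<noteq> y" if "y \<in> carrier G" for y
    using that t(1) by (metis l_one one_closed r_cancel)
  have "r dvd card {y \<in> C. t \<otimes> y \<noteq> y}"
  proof (rule prime_dvd_card_nonfixed_points[OF _ 2 _ r])
    show "finite C" using CG fin finite_subset by blast
    show "((\<otimes>) t ^^ r) y = y" if "y \<in> C" for y
      using tp[of y r] that CG \<open>t [^] r = \<one>\<close> by auto
  qed
  moreover have "{y \<in> C. t \<otimes> y \<noteq> y} = C" using ne CG by blast
  ultimately have 3: "r dvd card C" by simp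
  have "torsion G e = C \<union> {y \<in> torsion G e. f y \<noteq> y}" "C \<inter> {y \<in> torsion G e. f y \<noteq> y} = {}"
    by (auto simp: C_def)
  then have "card (torsion G e) = card C + card {y \<in> torsion G e. f y \<noteq> y}"
    using finT by (metis (no_types, lifting) card_Un_disjoint finite_Un)
  then show ?thesis using 1 3 by simp
qed

text \<open>The units modulo p act freely on the difference: each raises the p-part of an element to
  a power and leaves the rest alone, and the p-part is nontrivial there. Hence every orbit has p - 1
  elements.\<close>

lemma pred_prime_dvd_card_torsion_diff:
  assumes fin: "finite (carrier G)" and p: "Factorial_Ring.prime p" and cop: "coprime p e"
  shows "p - 1 dvd card (torsion G (p * e) - torsion G e)"
proof -
  define W where "W = torsion G (p * e) - torsion G e"
  \<comment> \<open>The idempotent modulo p * e that projects an element to its p-part: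
    \<open>x^\<epsilon>\<close> is the p-part of x and \<open>x^(1-\<epsilon>)\<close> the remaining
    factor.\<close>
  obtain \<epsilon> :: int where eps: "[\<epsilon> = 1] (mod int p)" "[\<epsilon> = 0] (mod int e)"
    using binary_chinese_remainder_int[of "int p" "int e" 1 0] cop by auto
  have pe: "int e dvd \<epsilon>" "int p dvd \<epsilon> - 1"
    using eps by (auto simp: cong_0_iff cong_iff_dvd_diff)
  have pp: "\<not> int p dvd \<epsilon>"
  proof
    assume "int p dvd \<epsilon>"
    then have "int p dvd 1" using pe(2) dvd_diff[of "int p" \<epsilon> "\<epsilon> - 1"] by simp
    then show False using p by (simp add: not_prime_unit)
  qed
  define f where "f s x = x [^] (1 - \<epsilon> + s * \<epsilon>)" for s :: int and x
  have W: "x \<in> carrier G" "ord x dvd p * e" "p dvd ord x" if "x \<in> W" for x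
  proof -
    show x: "x \<in> carrier G" using that by (auto simp: W_def torsion_def)
    show o: "ord x dvd p * e" using that x by (simp add: W_def torsion_def pow_eq_id)
    have "\<not> ord x dvd e" using that x by (simp add: W_def torsion_def pow_eq_id)
    then show "p dvd ord x" using o p
      by (metis coprime_commute coprime_dvd_mult_right_iff prime_imp_coprime)
  qed
  have f_eq: "f s x = f s' x \<longleftrightarrow> int p dvd s - s'" if "x \<in> W" for s s' x
  proof -
    have "f s x = f s' x \<longleftrightarrow> int (ord x) dvd (s' - s) * \<epsilon>"
      using W(1)[OF that] by (simp add: f_def int_pow_eq algebra_simps)
    also have "\<dots> \<longleftrightarrow> int p dvd s' - s"
    proof
      assume "int (ord x) dvd (s' - s) * \<epsilon>"
      then have "int p dvd (s' - s) * \<epsilon>" using W(3)[OF that] by (meson dvd_trans of_nat_dvd_iff)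
      then show "int p dvd s' - s" using pp p by (simp add: prime_dvd_mult_iff)
    next
      assume "int p dvd s' - s"
      then have "int p * int e dvd (s' - s) * \<epsilon>" using pe(1) mult_dvd_mono by blast
      then show "int (ord x) dvd (s' - s) * \<epsilon>" using W(2)[OF that]
        by (metis dvd_trans of_nat_dvd_iff of_nat_mult)
    qed
    finally show ?thesis by (simp add: dvd_diff_commute)
  qed
  \<comment> \<open>\<open>s -> f s\<close> is multiplicative because \<epsilon> is idempotent
    modulo p * e, a multiple of the order of x.\<close>
  have ff: "f r (f s x) = f (r * s) x" if "x \<in> W" for r s x
  proof -
    have "int p * int e dvd (\<epsilon> - 1) * \<epsilon>" using pe mult_dvd_mono by blast
    then have "int (ord x) dvd (\<epsilon> - 1) * \<epsilon>" using W(2)[OF that]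
      by (metis dvd_trans of_nat_dvd_iff of_nat_mult)
    then have "int (ord x) dvd (\<epsilon> - 1) * \<epsilon> * (r + s - 1 - r * s)" by simp
    moreover have "(\<epsilon> - 1) * \<epsilon> * (r + s - 1 - r * s) = (1 - \<epsilon> + r * s * \<epsilon>) - (1 - \<epsilon> + s * \<epsilon>) * (1 - \<epsilon> + r * \<epsilon>)"
      by (simp add: algebra_simps)
    ultimately show ?thesis using W(1)[OF that] by (simp add: f_def int_pow_pow int_pow_eq)
  qed
  have f1: "f 1 x = x" if "x \<in> W" for x using W(1)[OF that] by (simp add: f_def)
  have inverse: "\<exists>r. int p dvd r * s - 1" if "\<not> int p dvd s" for s
  proof -
    have "coprime (int p) s" using that p by (intro prime_imp_coprime) auto
    then have "coprime s (int p)" by (simp add: coprime_commute)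
    then obtain r where "[s * r = 1] (mod int p)" using cong_solve_coprime_int by blast
    then show ?thesis by (metis cong_iff_dvd_diff mult.commute)
  qed
  have fW: "f s x \<in> W" if "x \<in> W" "\<not> int p dvd s" for s x
  proof -
    have x: "x \<in> carrier G" using W that by blast
    have fG: "f s x \<in> carrier G" using x by (simp add: f_def)
    have pw: "(x [^] j) [^] n = (x [^] n) [^] j" for j :: int and n :: nat
      using x by (metis int_pow_int int_pow_pow mult.commute)
    have "f s x [^] (p * e) = \<one>" using that(1) unfolding f_def pw by (simp add: W_def torsion_def)
    moreover have "f s x [^] e \<noteq> \<one>"
    proof
      assume *: "f s x [^] e = \<one>"
      obtain r where r: "int p dvd r * s - 1" using inverse[OF \<open>\<not> int p dvd s\<close>] by blast
      have "x = f (r * s) x" using f_eq[OF that(1), of "r * s" 1] r f1[OF that(1)] by simp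
      then have xe: "x = (f s x) [^] (1 - \<epsilon> + r * \<epsilon>)" using ff[OF that(1)] by (simp add: f_def)
      have "((f s x) [^] (1 - \<epsilon> + r * \<epsilon>)) [^] e = ((f s x) [^] e) [^] (1 - \<epsilon> + r * \<epsilon>)"
        using fG by (metis int_pow_int int_pow_pow mult.commute)
      then have "x [^] e = \<one>" using * xe by simp
      then show False using that(1) by (auto simp: W_def torsion_def)
    qed
    ultimately show ?thesis using fG by (simp add: W_def torsion_def)
  qed
  define C where "C x = (\<lambda>s. f s x) ` {s. \<not> int p dvd s}" for x
  have cardC: "card (C x) = p - 1" if "x \<in> W" for x
  proof -
    have "f s x \<in> (\<lambda>s. f s x) ` {1..<int p}" if "\<not> int p dvd s" for s
    proof (rule image_eqI)
      show "f s x = f (s mod int p) x" using f_eq[OF \<open>x \<in> W\<close>] by (simp add: minus_mod_eq_mult_div)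
      have "s mod int p \<noteq> 0" using that by (simp add: dvd_eq_mod_eq_0)
      moreover have "s mod int p \<ge> 0" "s mod int p < int p" using prime_gt_0_nat[OF p] by simp_all
      ultimately show "s mod int p \<in> {1..<int p}" by simp
    qed
    moreover have "\<not> int p dvd s" if "s \<in> {1..<int p}" for s using that zdvd_not_zless by auto
    ultimately have "C x = (\<lambda>s. f s x) ` {1..<int p}" by (auto simp: C_def)
    moreover have "inj_on (\<lambda>s. f s x) {1..<int p}"
    proof (rule inj_onI)
      fix s s' assume *: "s \<in> {1..<int p}" "s' \<in> {1..<int p}" "f s x = f s' x"
      then have "int p dvd s - s'" using f_eq[OF \<open>x \<in> W\<close>] by blast
      moreover have "\<bar>s - s'\<bar> < int p" using * by auto
      ultimately show "s = s'" using dvd_imp_le_int[of "s - s'" "int p"] by linarith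
    qed
    ultimately show ?thesis by (simp add: card_image)
  qed
  have C_eqI: "C (f s x) = C x" if "x \<in> W" "\<not> int p dvd s" for s x
  proof -
    have "f r (f s x) \<in> C x" if "\<not> int p dvd r" for r
      using ff[OF \<open>x \<in> W\<close>] that \<open>\<not> int p dvd s\<close> p by (simp add: C_def prime_dvd_mult_iff)
    moreover have "f r x \<in> C (f s x)" if "\<not> int p dvd r" for r
    proof -
      obtain s' where s': "int p dvd s' * s - 1" using inverse[OF \<open>\<not> int p dvd s\<close>] by blast
      then have "int p dvd (s' * s - 1) * r" by simp
      moreover have "(s' * s - 1) * r = (r * s') * s - r" by (simp add: algebra_simps)
      ultimately have *: "int p dvd (r * s') * s - r" by simp
      have "\<not> int p dvd r * s'"
      proof
        assume "int p dvd r * s'"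
        then have "int p dvd (r * s') * s" by (rule dvd_mult2)
        from dvd_diff[OF this *] show False using that by simp
      qed
      moreover have "f (r * s') (f s x) = f r x" using * ff[OF \<open>x \<in> W\<close>] f_eq[OF \<open>x \<in> W\<close>] by simp
      ultimately show ?thesis unfolding C_def by (intro image_eqI[of _ _ "r * s'"]) simp_all
    qed
    ultimately show ?thesis by (auto simp: C_def)
  qed
  have un: "\<Union>(C ` W) = W"
  proof
    show "\<Union>(C ` W) \<subseteq> W" using fW by (auto simp: C_def)
    have "\<not> int p dvd 1" using prime_gt_1_nat[OF p] by simp
    then have "x \<in> C x" if "x \<in> W" for x
      using f1[OF that] unfolding C_def by (intro image_eqI[of _ _ 1]) simp_all
    then show "W \<subseteq> \<Union>(C ` W)" by auto
  qed
  have "p - 1 dvd card (\<Union>(C ` W))"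
  proof (rule dvd_partition)
    show "finite (\<Union>(C ` W))" using un fin by (simp add: W_def torsion_def)
    show "\<forall>c\<in>C ` W. p - 1 dvd card c" using cardC by auto
    show "\<forall>c1\<in>C ` W. \<forall>c2\<in>C ` W. c1 \<noteq> c2 \<longrightarrow> c1 \<inter> c2 = {}"
    proof (intro ballI impI, rule ccontr)
      fix c1 c2 assume *: "c1 \<in> C ` W" "c2 \<in> C ` W" "c1 \<noteq> c2" "c1 \<inter> c2 \<noteq> {}"
      then obtain x y where xy: "x \<in> W" "y \<in> W" "c1 = C x" "c2 = C y" by auto
      with * obtain s s' where "f s x = f s' y" "\<not> int p dvd s" "\<not> int p dvd s'"
        by (auto simp: C_def)
      then have "C x = C y" using C_eqI xy by metis
      then show False using * xy by simp
    qed
  qed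
  then show ?thesis using un W_def by simp
qed

text \<open>Pass from p * d to d, where p is the largest prime of n/d. Divisibility by the primes of
  d gives d * c solutions. The p * d - d * c elements that are lost come in blocks of p - 1, and p -
  1 is coprime to d because all primes of d exceed p. So p - 1 divides p - c, and 0 < c < p leaves
  only c = 1.\<close>

lemma card_torsion_upper:
  assumes fin: "finite (carrier G)" and sq: "squarefree (order G)"
  shows "d dvd order G \<Longrightarrow>
    (\<And>r s. Factorial_Ring.prime r \<Longrightarrow> Factorial_Ring.prime s \<Longrightarrow> r dvd d \<Longrightarrow> s dvd order G div d \<Longrightarrow> s < r) \<Longrightarrow>
    card (torsion G d) = d"
proof (induction "order G div d" arbitrary: d rule: less_induct)
  case less
  have n0: "order G > 0" using fin order_gt_0_iff_finite by blast
  have d0: "d > 0" using less.prems(1) n0 by (metis dvd_0_left_iff gr0I not_gr_zero)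
  have nd0: "order G div d > 0" using less.prems(1) n0 by (auto elim!: dvdE)
  have finT: "finite (torsion G e)" for e using fin by (simp add: torsion_def)
  show ?case
  proof (cases "order G div d = 1")
    case True
    then have "d = order G" using less.prems(1) by (metis dvd_mult_div_cancel mult.right_neutral)
    then have "torsion G d = carrier G" using pow_order_eq_1 by (auto simp: torsion_def)
    then show ?thesis using \<open>d = order G\<close> by (simp add: order_def)
  next
    case False
    define P where "P = {s. Factorial_Ring.prime s \<and> s dvd order G div d}"
    have "finite P" using nd0 unfolding P_def by (simp add: finite_divisors_nat)
    moreover have "P \<noteq> {}" using False prime_factor_nat[of "order G div d"] by (auto simp: P_def)
    ultimately have Max: "Max P \<in> P" "\<And>s. s \<in> P \<Longrightarrow> s \<le> Max P" by auto
    define p where "p = Max P"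
    have p: "Factorial_Ring.prime p" "p dvd order G div d" using Max(1) by (auto simp: p_def P_def)
    obtain g where g: "order G div d = p * g" using p(2) by (elim dvdE)
    then have n: "order G = (p * d) * g"
      using dvd_mult_div_cancel[OF less.prems(1)] by (simp add: ac_simps)
    have pd_dvd: "p * d dvd order G" using n by simp
    have div: "order G div (p * d) = g" using n n0 by simp
    have smaller: "order G div (p * d) < order G div d"
      unfolding div g using n n0 prime_gt_1_nat[OF p(1)] by simp
    have cop: "coprime p d" using p less.prems(2) prime_imp_coprime by blast
    have "card (torsion G (p * d)) = p * d"
    proof (rule less.hyps[OF smaller pd_dvd])
      fix r s assume rs: "Factorial_Ring.prime r" "Factorial_Ring.prime s" "r dvd p * d" "s dvd order G div (p * d)"
      have s: "s dvd order G div d" using rs(4) unfolding div g by simp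
      from rs(3) consider "r dvd d" | "r dvd p" using rs(1) prime_dvd_mult_nat by blast
      then show "s < r"
      proof cases
        case 1 then show ?thesis using less.prems(2) rs s by blast
      next
        case 2
        then have "r = p" using rs(1) p(1) primes_dvd_imp_eq by blast
        moreover have "s \<noteq> p"
        proof
          assume "s = p"
          then have "p dvd g" using rs(4) unfolding div by simp
          then have "p ^ 2 dvd order G" unfolding n power2_eq_square by (intro mult_dvd_mono) auto
          then have "is_unit p" using sq unfolding squarefree_def by blast
          then show False using p(1) by (simp add: not_prime_unit)
        qed
        moreover have "s \<le> p" using Max(2) s rs(2) by (simp add: p_def P_def)
        ultimately show ?thesis by simp
      qed
    qed
    have sub: "torsion G d \<subseteq> torsion G (p * d)"
      by (auto simp: torsion_def pow_eq_id)
    have "squarefree d" using sq less.prems(1) squarefree_mono by blast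
    \<comment> \<open>As d is squarefree, divisibility by each of its primes is enough.\<close>
    have "d dvd card (torsion G d)"
    proof (rule multiplicity_le_imp_dvd)
      show "d \<noteq> 0" using d0 by simp
      fix r assume r: "Factorial_Ring.prime (r::nat)"
      show "multiplicity r d \<le> multiplicity r (card (torsion G d))"
      proof (cases "r dvd d")
        case True
        then have "r dvd card (torsion G d)"
          using prime_dvd_card_torsion[OF fin r True] less.prems(1) dvd_trans by blast
        moreover have "card (torsion G d) \<noteq> 0"
          using finT[of d] by (auto simp: torsion_def)
        ultimately have "multiplicity r (card (torsion G d)) \<ge> 1"
          using r multiplicity_gt_zero_iff[of "card (torsion G d)" r] prime_gt_1_nat[OF r]
          by (auto simp: Suc_le_eq)
        moreover have "multiplicity r d = 1"
          using \<open>squarefree d\<close> True r d0 by (simp add: squarefree_factorial_semiring' in_prime_factors_iff)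
        ultimately show ?thesis by simp
      qed (simp add: not_dvd_imp_multiplicity_0)
    qed
    then obtain c where c: "card (torsion G d) = d * c" by (elim dvdE)
    have "card (torsion G (p * d) - torsion G d) = p * d - d * c"
      using card_Diff_subset[OF finT sub] \<open>card (torsion G (p * d)) = p * d\<close> c by simp
    also have "\<dots> = (p - c) * d" by (simp add: diff_mult_distrib mult.commute[of d c])
    finally have dvd: "p - 1 dvd (p - c) * d" using pred_prime_dvd_card_torsion_diff[OF fin p(1) cop] by simp
    have "coprime (p - 1) d"
    proof (rule ccontr)
      assume "\<not> coprime (p - 1) d"
      then have "gcd (p - 1) d \<noteq> 1" by (simp add: coprime_iff_gcd_eq_1)
      then obtain r where r: "Factorial_Ring.prime r" "r dvd p - 1" "r dvd d"
        using prime_factor_nat[of "gcd (p - 1) d"] by auto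
      then have "p < r" using less.prems(2) p by blast
      then show False using dvd_imp_le[OF r(2)] prime_gt_1_nat[OF p(1)] by simp
    qed
    then have dvd': "p - 1 dvd p - c" using dvd by (metis coprime_dvd_mult_left_iff)
    \<comment> \<open>An element of order p solves the equation for p * d but not the one for d,
      which gives c < p.\<close>
    obtain t where t: "t \<in> carrier G" "ord t = p"
      using exists_elem_prime_ord[OF fin p(1)] pd_dvd by (metis dvd_mult_left)
    have "t \<in> torsion G (p * d)" using t by (simp add: torsion_def pow_eq_id)
    moreover have "t \<notin> torsion G d"
    proof -
      have "\<not> p dvd d" using cop p(1) coprime_absorb_left not_prime_unit by blast
      then show ?thesis using t by (simp add: torsion_def pow_eq_id)
    qed
    ultimately have "torsion G d \<subset> torsion G (p * d)" using sub by blast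
    then have "d * c < p * d"
      using psubset_card_mono[OF finT] c \<open>card (torsion G (p * d)) = p * d\<close> by metis
    then have "c < p" by (simp add: mult.commute)
    moreover have "\<one> \<in> torsion G d" by (simp add: torsion_def)
    then have "card (torsion G d) \<noteq> 0" using finT card_0_eq by blast
    then have "c \<noteq> 0" using c by auto
    ultimately have "c = 1" using dvd_imp_le[OF dvd'] by simp
    then show ?thesis using c by simp
  qed
qed

text \<open>For the largest prime q there are exactly q solutions of x^q = 1, and the powers of a
  single t of order q already account for them. Speaking of solutions makes normality of <t>
  immediate, since a conjugate of t is again a solution.\<close>

lemma squarefree_unique_prime_subgroup:
  assumes fin: "finite (carrier G)" and sq: "squarefree (order G)" and n1: "order G \<noteq> 1"
  obtains q t where "Factorial_Ring.prime q" "q dvd order G" "t \<in> carrier G" "ord t = q"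
    "\<And>x. x \<in> carrier G \<Longrightarrow> x [^] q = \<one> \<Longrightarrow> \<exists>i::int. x = t [^] i"
proof -
  define P where "P = {s. Factorial_Ring.prime s \<and> s dvd order G}"
  have n0: "order G > 0" using fin order_gt_0_iff_finite by blast
  have "finite P" using n0 unfolding P_def by (simp add: finite_divisors_nat)
  moreover have "P \<noteq> {}" using n1 prime_factor_nat by (auto simp: P_def)
  ultimately have Max: "Max P \<in> P" "\<And>s. s \<in> P \<Longrightarrow> s \<le> Max P" by auto
  define q where "q = Max P"
  have q: "Factorial_Ring.prime q" "q dvd order G" using Max(1) by (auto simp: q_def P_def)
  have card: "card (torsion G q) = q"
  proof (rule card_torsion_upper[OF fin sq q(2)])
    fix r s assume rs: "Factorial_Ring.prime r" "Factorial_Ring.prime s" "r dvd q" "s dvd order G div q"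
    have "r = q" using rs q(1) primes_dvd_imp_eq by blast
    have "s * q dvd (order G div q) * q" using rs(4) by (rule mult_dvd_mono) simp
    then have sq': "s * q dvd order G" using q(2) by simp
    have "s \<noteq> q"
    proof
      assume "s = q"
      then have "q ^ 2 dvd order G" using sq' by (simp add: power2_eq_square)
      then have "is_unit q" using sq unfolding squarefree_def by blast
      then show False using q(1) by (simp add: not_prime_unit)
    qed
    moreover have "s \<in> P" using sq' rs(2) dvd_mult_left unfolding P_def by blast
    then have "s \<le> q" unfolding q_def by (rule Max(2))
    ultimately show "s < r" using \<open>r = q\<close> by simp
  qed
  obtain t where t: "t \<in> carrier G" "ord t = q"
    using exists_elem_prime_ord[OF fin q] .
  have finT: "finite (torsion G q)" using fin by (simp add: torsion_def)
  have "(\<lambda>i. t [^] int i) ` {..<q} \<subseteq> torsion G q"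
  proof clarify
    fix i
    have "(t [^] i) [^] q = t [^] (i * q)" using t(1) by (rule nat_pow_pow)
    then have "(t [^] i) [^] q = \<one>" using t pow_eq_id by simp
    then show "t [^] int i \<in> torsion G q" using t by (simp add: torsion_def int_pow_int)
  qed
  moreover have "inj_on (\<lambda>i. t [^] int i) {..<q}"
  proof (rule inj_onI)
    fix i j assume *: "i \<in> {..<q}" "j \<in> {..<q}" "t [^] int i = t [^] int j"
    then have "int q dvd int j - int i" using t int_pow_eq[of t "int i" "int j"] by simp
    moreover have "\<bar>int j - int i\<bar> < int q" using * by auto
    ultimately show "i = j" using dvd_imp_le_int[of "int j - int i" "int q"] by linarith
  qed
  ultimately have "(\<lambda>i. t [^] int i) ` {..<q} = torsion G q"
    using card by (intro card_subset_eq[OF finT]) (simp_all add: card_image)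
  then have "\<exists>i::int. x = t [^] i" if "x \<in> carrier G" "x [^] q = \<one>" for x
    using that unfolding torsion_def by blast
  with q t show ?thesis using that by blast
qed

end

section \<open>Metacyclic structure of groups of squarefree order\<close>

context group
begin

lemma conj_int_pow:
  assumes "t \<in> carrier G" "y \<in> carrier G"
  shows "(t \<otimes> y \<otimes> inv t) [^] (i::int) = t \<otimes> y [^] i \<otimes> inv t"
proof (cases i rule: int_cases2)
  case (nonneg n)
  then show ?thesis using assms by (simp add: int_pow_int conj_nat_pow)
next
  case (nonpos n)
  have "inv (t \<otimes> y [^] n \<otimes> inv t) = t \<otimes> inv (y [^] n) \<otimes> inv t"
    using assms by (simp add: inv_mult_group m_assoc)
  then show ?thesis using assms nonpos by (simp add: int_pow_neg int_pow_int conj_nat_pow)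
qed

lemma twist_int_pow:
  assumes "x \<in> carrier G" "y \<in> carrier G" "x \<otimes> y = y [^] (l::int) \<otimes> x"
  shows "x \<otimes> y [^] (i::int) = y [^] (l * i) \<otimes> x"
proof -
  have "x \<otimes> y \<otimes> inv x = y [^] l" using assms by (simp add: inv_solve_right')
  then have "x \<otimes> y [^] i \<otimes> inv x = y [^] (l * i)"
    using conj_int_pow[of x y i] assms by (simp add: int_pow_pow)
  then show ?thesis using assms by (metis inv_solve_right' int_pow_closed m_closed)
qed

lemma twist_nat_int_pow:
  assumes "x \<in> carrier G" "y \<in> carrier G" "x \<otimes> y = y [^] (l::int) \<otimes> x"
  shows "x [^] (n::nat) \<otimes> y [^] (i::int) = y [^] (l ^ n * i) \<otimes> x [^] n"
proof (induction n arbitrary: i)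
  case (Suc n)
  have "x [^] Suc n \<otimes> y [^] i = x [^] n \<otimes> (x \<otimes> y [^] i)" using assms by (simp add: m_assoc)
  also have "\<dots> = (x [^] n \<otimes> y [^] (l * i)) \<otimes> x" using assms by (simp add: twist_int_pow m_assoc)
  also have "\<dots> = y [^] (l ^ Suc n * i) \<otimes> x [^] Suc n"
    using assms by (simp add: Suc m_assoc ac_simps)
  finally show ?case .
qed (use assms in simp)

lemma ord_mult_coprime:
  assumes "x \<otimes> y = y \<otimes> x" "x \<in> carrier G" "y \<in> carrier G" "coprime (ord x) (ord y)"
  shows "ord (x \<otimes> y) = ord x * ord y"
proof (rule dvd_antisym)
  show "ord (x \<otimes> y) dvd ord x * ord y" using ord_mul_divides assms(1-3) by blast
  have one: "x [^] ord (x \<otimes> y) \<otimes> y [^] ord (x \<otimes> y) = \<one>"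
    using pow_mult_distrib[OF assms(1-3), of "ord (x \<otimes> y)"] assms(2,3) by simp
  define n where "n = ord (x \<otimes> y)"
  have pw: "x [^] (n * k) \<otimes> y [^] (n * k) = \<one>" for k
  proof -
    have "(x \<otimes> y) [^] (n * k) = \<one>" using assms(2,3) pow_eq_id[of "x \<otimes> y" "n * k"] n_def by simp
    then show ?thesis using pow_mult_distrib[OF assms(1-3), of "n * k"] by simp
  qed
  have "y [^] (n * ord y) = \<one>" using pow_eq_id assms(3) by simp
  then have "x [^] (n * ord y) = \<one>" using pw[of "ord y"] assms(2) by simp
  then have "ord x dvd n * ord y" using pow_eq_id assms(2) by blast
  then have 1: "ord x dvd n" using assms(4) by (metis coprime_dvd_mult_left_iff)
  have "x [^] (n * ord x) = \<one>" using pow_eq_id assms(2) by simp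
  then have "y [^] (n * ord x) = \<one>" using pw[of "ord x"] assms(3) by simp
  then have "ord y dvd n * ord x" using pow_eq_id assms(3) by blast
  then have 2: "ord y dvd n" using assms(4) by (metis coprime_commute coprime_dvd_mult_left_iff)
  show "ord x * ord y dvd ord (x \<otimes> y)"
    using divides_mult[OF 1 2 assms(4)] n_def by simp
qed

(* The quotient is realised on coset representatives, so that it stays in the
   type of G and an induction over groups of a fixed type can use it. *)
lemma quotient_on_same_type:
  assumes N: "N \<lhd> G"
  obtains K :: "'a monoid" and h where "group_hom G K h" "h ` carrier G = carrier K"
    "kernel G K h = N" "order K * card N = order G"
proof -
  interpret N: normal N G by (rule N)
  define f where "f x = (SOME y. y \<in> N #> x)" for x
  have weak: "weak_group_morphism f N G"
  proof (rule weak_group_morphismsI[OF N])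
    fix a b assume ab: "a \<in> carrier G" "b \<in> carrier G"
    have fmem: "f x \<in> N #> x" if "x \<in> carrier G" for x
      unfolding f_def using rcos_self[OF that N.subgroup_axioms] by (rule someI)
    have "f a = f b \<longleftrightarrow> N #> a = N #> b"
    proof
      assume "f a = f b"
      then have "f a \<in> N #> a" "f a \<in> N #> b" using fmem ab by metis+
      then show "N #> a = N #> b" using repr_independence[OF _ _ N.subgroup_axioms] ab by metis
    qed (simp add: f_def)
    also have "\<dots> \<longleftrightarrow> a \<in> N #> b"
      using rcos_self[OF ab(1) N.subgroup_axioms] repr_independence[OF _ ab(2) N.subgroup_axioms] by metis
    also have "\<dots> \<longleftrightarrow> a \<otimes> inv b \<in> N" using N.rcos_module[OF is_group ab(2,1)] .
    finally show "f a = f b \<longleftrightarrow> a \<otimes> inv b \<in> N" .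
  qed
  define K where "K = image_group f G"
  have gh: "group_hom G K f" unfolding K_def by (rule weak_group_morphism_group_hom[OF weak])
  have ker: "kernel G K f = N" unfolding K_def by (rule weak_group_morphism_ker[OF weak])
  have surj: "f ` carrier G = carrier K" by (simp add: K_def image_group_carrier)
  have "(\<lambda>W. the_elem (f ` W)) \<in> iso (G Mod N) K"
    using group_hom.FactGroup_iso_set[OF gh surj] ker by simp
  then have "card (carrier (G Mod N)) = order K"
    by (auto simp: iso_def order_def dest: bij_betw_same_card)
  then have "order K * card N = order G"
    using lagrange[OF N.subgroup_axioms] by (simp add: FactGroup_def)
  with gh surj ker show ?thesis by (rule that)
qed

lemma normal_powersI:
  assumes "t \<in> carrier G" "\<And>x. x \<in> carrier G \<Longrightarrow> \<exists>i::int. x \<otimes> t \<otimes> inv x = t [^] i"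
  shows "range (\<lambda>i::int. t [^] i) \<lhd> G"
proof -
  have "x \<otimes> t [^] j \<otimes> inv x \<in> range (\<lambda>i::int. t [^] i)" if "x \<in> carrier G" for x and j :: int
  proof -
    obtain i :: int where "x \<otimes> t \<otimes> inv x = t [^] i" using assms(2)[OF \<open>x \<in> carrier G\<close>] by blast
    then have "x \<otimes> t [^] j \<otimes> inv x = t [^] (i * j)"
      using conj_int_pow[OF that assms(1), of j] assms(1) by (simp add: int_pow_pow)
    then show ?thesis by simp
  qed
  then show ?thesis using subgroup_of_powers[OF assms(1)] by (auto simp: normal_inv_iff)
qed

lemma card_powers:
  assumes "t \<in> carrier G"
  shows "card (range (\<lambda>i::int. t [^] i)) = ord t"
proof -
  have "range (\<lambda>i::int. t [^] i) = carrier (subgroup_generated G {t})"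
    using carrier_subgroup_generated_by_singleton[OF assms] by simp
  then show ?thesis using cyclic_order_is_ord[OF assms] by (simp add: order_def)
qed

end

text \<open>Any preimage of x has order dividing n * q, where n is the order of x. Its power with an
  exponent that is 1 modulo n and 0 modulo q has the same image and loses the part of the order that
  comes from the kernel.\<close>

lemma (in group_hom) lift_same_ord:
  assumes surj: "h ` carrier G = carrier H"
    and x: "x \<in> carrier H" and cop: "coprime (group.ord H x) q"
    and ker: "\<And>y. y \<in> kernel G H h \<Longrightarrow> y [^] q = \<one>"
  obtains a where "a \<in> carrier G" "h a = x" "group.ord G a = group.ord H x"
proof -
  define n where "n = H.ord x"
  have "x \<in> h ` carrier G" using surj x by simp
  then obtain a1 where a1: "a1 \<in> carrier G" "h a1 = x" by auto
  obtain e :: nat where e: "[e = 1] (mod n)" "[e = 0] (mod q)"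
    using binary_chinese_remainder_nat[of n q 1 0] cop n_def by auto
  have "h (a1 [^] n) = \<one>\<^bsub>H\<^esub>" using a1 x by (simp add: hom_nat_pow n_def)
  then have "(a1 [^] n) [^] q = \<one>" using a1 by (intro ker) (simp add: kernel_def)
  then have o: "G.ord a1 dvd n * q" using a1 by (simp add: G.nat_pow_pow G.pow_eq_id)
  define a where "a = a1 [^] e"
  have aG: "a \<in> carrier G" using a1 by (simp add: a_def)
  have "h a = x [^]\<^bsub>H\<^esub> e" using a1 by (simp add: a_def hom_nat_pow)
  also have "\<dots> = x [^]\<^bsub>H\<^esub> (1::nat)"
  proof -
    have "int n dvd 1 - int e"
      using e(1) by (metis cong_iff_dvd_diff cong_int_iff cong_sym of_nat_1)
    then have "x [^]\<^bsub>H\<^esub> int e = x [^]\<^bsub>H\<^esub> int 1"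
      using H.int_pow_eq[OF x, of "int e" "int 1"] n_def by simp
    then show ?thesis by (simp only: int_pow_int)
  qed
  finally have ha: "h a = x" using x by simp
  have "n * q dvd e * n" using e(2) by (simp add: cong_0_iff mult.commute mult_dvd_mono)
  then have "G.ord a1 dvd e * n" using o dvd_trans by blast
  then have "a [^] n = \<one>" using a1 by (simp add: a_def G.nat_pow_pow G.pow_eq_id)
  then have "G.ord a dvd n" using aG G.pow_eq_id by blast
  moreover have "x [^]\<^bsub>H\<^esub> G.ord a = \<one>\<^bsub>H\<^esub>"
    using hom_nat_pow[OF aG, of "G.ord a"] aG ha by simp
  then have "n dvd G.ord a" using H.pow_eq_id[OF x] n_def by blast
  ultimately have "G.ord a = n" by (rule dvd_antisym)
  with aG ha show ?thesis using that n_def by blast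
qed

lemma squarefree_mult_imp_coprime:
  assumes "squarefree (x * y :: nat)" shows "coprime x y"
proof (rule coprimeI)
  fix d assume "d dvd x" "d dvd y"
  then have "d ^ 2 dvd x * y" unfolding power2_eq_square by (rule mult_dvd_mono)
  then show "is_unit d" using assms by (rule squarefreeD[rotated])
qed

lemma (in group) commute_int_pow:
  assumes "x \<in> carrier G" "y \<in> carrier G" "x \<otimes> y = y \<otimes> x"
  shows "x \<otimes> y [^] (i::int) = y [^] i \<otimes> x"
  using twist_int_pow[of x y 1 i] assms by simp

text \<open>The last condition says that the commutator \<open>a^(l-1)\<close> of b and a generates
  <a>; it is the invariant that carries the induction. A predicate on the group, rather than a
  locale, lets the induction quantify over groups.\<close>

definition metacyclic_pair :: "('a, 'b) monoid_scheme \<Rightarrow> 'a \<Rightarrow> 'a \<Rightarrow> int \<Rightarrow> bool" where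
  "metacyclic_pair G a b l \<longleftrightarrow> a \<in> carrier G \<and> b \<in> carrier G \<and>
     group.ord G a * group.ord G b = order G \<and>
     b \<otimes>\<^bsub>G\<^esub> a = a [^]\<^bsub>G\<^esub> l \<otimes>\<^bsub>G\<^esub> b \<and> coprime (l - 1) (int (group.ord G a))"

text \<open>Divide by the normal subgroup <t> of prime order q and lift a pair from the quotient
  without changing orders. Automorphisms of <t> commute, so the commutator \<open>a^(l-1)\<close>
  centralises t, and with it a, which is a power of that commutator. It remains to merge t with b if
  b centralises t, and with a otherwise.\<close>

lemma (in group) metacyclic_pair_step:
  assumes fin: "finite (carrier G)" and sq: "squarefree (order G)"
    and IH: "\<And>K :: 'a monoid. group K \<Longrightarrow> finite (carrier K) \<Longrightarrow> squarefree (order K) \<Longrightarrow>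
      order K < order G \<Longrightarrow> \<exists>a b l. metacyclic_pair K a b l"
  shows "\<exists>a b l. metacyclic_pair G a b l"
proof -
  show ?thesis
  proof (cases "order G = 1")
    case True
    then show ?thesis by (intro exI[of _ \<one>] exI[of _ 0]) (auto simp: metacyclic_pair_def)
  next
    case False
    obtain q t where q: "Factorial_Ring.prime q" and t: "t \<in> carrier G" "ord t = q"
      and uniq: "\<And>x. x \<in> carrier G \<Longrightarrow> x [^] q = \<one> \<Longrightarrow> \<exists>i::int. x = t [^] i"
      using squarefree_unique_prime_subgroup[OF fin sq False] by metis
    have tq: "t [^] q = \<one>" using t pow_ord_eq_1 by blast
    have conj_t: "\<exists>i::int. x \<otimes> t \<otimes> inv x = t [^] i" if "x \<in> carrier G" for x
      using that t(1) tq by (intro uniq) (simp_all add: conj_nat_pow)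
    define N where "N = range (\<lambda>i::int. t [^] i)"
    have N: "N \<lhd> G" unfolding N_def by (rule normal_powersI[OF t(1) conj_t])
    have cardN: "card N = q" using card_powers[OF t(1)] t(2) by (simp add: N_def)
    obtain K :: "'a monoid" and h where K: "group_hom G K h" "h ` carrier G = carrier K"
      "kernel G K h = N" "order K * q = order G"
      using quotient_on_same_type[OF N] unfolding cardN by metis
    interpret h: group_hom G K h by (rule K(1))
    have n0: "order G > 0" using fin order_gt_0_iff_finite by blast
    have cop_Kq: "coprime (order K) q" and sqK: "squarefree (order K)"
      using sq unfolding K(4)[symmetric] by (auto intro: squarefree_mult_imp_coprime dest: squarefree_multD)
    have "order K < order G" using K(4) n0 prime_gt_1_nat[OF q]
      by (metis mult.right_neutral mult_less_cancel1 nat_0_less_mult_iff)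
    moreover have "finite (carrier K)" using K(2) fin by (metis finite_imageI)
    ultimately obtain a' b' l where IH: "a' \<in> carrier K" "b' \<in> carrier K" "h.H.ord a' * h.H.ord b' = order K"
      "b' \<otimes>\<^bsub>K\<^esub> a' = a' [^]\<^bsub>K\<^esub> l \<otimes>\<^bsub>K\<^esub> b'" "coprime (l - 1) (int (h.H.ord a'))"
      using assms(3)[of K] sqK h.H.is_group unfolding metacyclic_pair_def by blast
    have cop: "coprime (h.H.ord a') q" "coprime (h.H.ord b') q"
      using cop_Kq unfolding IH(3)[symmetric] by simp_all
    have kerq: "y [^] q = \<one>" if "y \<in> kernel G K h" for y
    proof -
      obtain i :: int where "y = t [^] i" using \<open>y \<in> kernel G K h\<close> unfolding K(3) N_def by blast
      then have "y [^] int q = (t [^] int q) [^] i"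
        using t(1) by (simp add: int_pow_pow mult.commute)
      then show ?thesis using tq by (simp add: int_pow_int)
    qed
    obtain a where a: "a \<in> carrier G" "h a = a'" "ord a = h.H.ord a'"
      using h.lift_same_ord[OF K(2) IH(1) cop(1) kerq] by blast
    obtain b where b: "b \<in> carrier G" "h b = b'" "ord b = h.H.ord b'"
      using h.lift_same_ord[OF K(2) IH(2) cop(2) kerq] by blast
    define w where "w = b \<otimes> a \<otimes> inv b"
    have w: "w \<in> carrier G" using a b by (simp add: w_def)
    have ali: "a [^] l \<in> carrier G" using a by simp
    have "h (b \<otimes> a) = h (a [^] l \<otimes> b)"
      using IH(4) a(1,2) b(1,2) h.hom_int_pow by simp
    then have "h w = h (a [^] l)"
      unfolding w_def using a(1) b(1) ali h.hom_mult h.hom_inv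
      by (metis h.H.inv_solve_right' h.hom_closed inv_closed m_closed)
    then have "w \<otimes> inv (a [^] l) \<in> kernel G K h"
      using w ali by (simp add: kernel_def)
    then obtain i :: int where i: "w \<otimes> inv (a [^] l) = t [^] i" unfolding K(3) N_def by blast
    then have wi: "w = t [^] i \<otimes> a [^] l" using w ali t(1) by (metis inv_solve_right' int_pow_closed)
    \<comment> \<open>The exponents by which a, b and the inverse of b act on <t>.\<close>
    obtain \<alpha> :: int where al: "a \<otimes> t \<otimes> inv a = t [^] \<alpha>" using conj_t[OF a(1)] by blast
    obtain \<beta> :: int where be: "b \<otimes> t \<otimes> inv b = t [^] \<beta>" using conj_t[OF b(1)] by blast
    obtain \<gamma> :: int where ga: "inv b \<otimes> t \<otimes> inv (inv b) = t [^] \<gamma>" using conj_t[of "inv b"] b(1) by blast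
    have at: "a \<otimes> t = t [^] \<alpha> \<otimes> a" using al a(1) t(1) by (metis inv_solve_right' int_pow_closed m_closed)
    have bt: "b \<otimes> t = t [^] \<beta> \<otimes> b" using be b(1) t(1) by (metis inv_solve_right' int_pow_closed m_closed)
    have bit: "inv b \<otimes> t = t [^] \<gamma> \<otimes> inv b" using ga b(1) t(1)
      by (metis inv_solve_right' int_pow_closed m_closed inv_closed)
    have "t = b \<otimes> (inv b \<otimes> t)" using b(1) t(1) by (simp add: m_assoc[symmetric])
    also have "\<dots> = b \<otimes> t [^] \<gamma> \<otimes> inv b" using bit b(1) t(1) by (simp add: m_assoc)
    also have "b \<otimes> t [^] \<gamma> = t [^] (\<beta> * \<gamma>) \<otimes> b" using twist_int_pow[OF b(1) t(1) bt] .
    also have "t [^] (\<beta> * \<gamma>) \<otimes> b \<otimes> inv b = t [^] (\<beta> * \<gamma>)" using b(1) t(1) by (simp add: m_assoc)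
    finally have tbg: "t [^] (\<beta> * \<gamma>) = t" by simp
    \<comment> \<open>The conjugate w of a by b acts on t as a does, because the exponents of b and
      of its inverse cancel. Since w differs from \<open>a^l\<close> by a power of t,
      \<open>a^l\<close> acts in the same way.\<close>
    have wt: "w \<otimes> t = t [^] \<alpha> \<otimes> w"
    proof -
      have "w \<otimes> t = b \<otimes> a \<otimes> (inv b \<otimes> t)" using a(1) b(1) t(1) by (simp add: w_def m_assoc)
      also have "\<dots> = b \<otimes> (a \<otimes> t [^] \<gamma>) \<otimes> inv b" using a(1) b(1) t(1) bit by (simp add: m_assoc)
      also have "\<dots> = (b \<otimes> t [^] (\<alpha> * \<gamma>)) \<otimes> a \<otimes> inv b"
        using a(1) b(1) t(1) by (simp add: twist_int_pow[OF a(1) t(1) at] m_assoc)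
      also have "\<dots> = t [^] (\<beta> * (\<alpha> * \<gamma>)) \<otimes> w"
        using a(1) b(1) t(1) by (simp add: twist_int_pow[OF b(1) t(1) bt] w_def m_assoc)
      also have "t [^] (\<beta> * (\<alpha> * \<gamma>)) = (t [^] (\<beta> * \<gamma>)) [^] \<alpha>"
        using t(1) by (simp only: int_pow_pow) (simp add: ac_simps)
      finally show ?thesis using tbg by simp
    qed
    have alt: "a [^] l \<otimes> t = t [^] \<alpha> \<otimes> a [^] l"
    proof -
      have "t [^] i \<otimes> (a [^] l \<otimes> t) = w \<otimes> t" using wi ali t(1) by (simp add: m_assoc)
      also have "\<dots> = t [^] \<alpha> \<otimes> (t [^] i \<otimes> a [^] l)" using wt wi by simp
      also have "\<dots> = t [^] i \<otimes> (t [^] \<alpha> \<otimes> a [^] l)"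
        using t(1) ali by (simp add: m_assoc[symmetric] int_pow_mult[symmetric] add.commute)
      finally show ?thesis using t(1) ali by simp
    qed
    define c where "c = a [^] (l - 1)"
    have c: "c \<in> carrier G" using a(1) by (simp add: c_def)
    have ac: "a \<otimes> c = a [^] l" using int_pow_mult[OF a(1), of 1 "l - 1"] a(1) by (simp add: c_def)
    have ca: "c \<otimes> a = a [^] l" using int_pow_mult[OF a(1), of "l - 1" 1] a(1) by (simp add: c_def)
    have tc: "t \<otimes> c = c \<otimes> t"
    proof -
      have "a \<otimes> (c \<otimes> t) = t [^] \<alpha> \<otimes> (a \<otimes> c)" using alt ac a(1) c t(1) by (simp add: m_assoc[symmetric])
      also have "\<dots> = a \<otimes> (t \<otimes> c)" using at a(1) c t(1) by (simp add: m_assoc[symmetric])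
      finally show ?thesis using a(1) c t(1) by simp
    qed
    have cop_l: "coprime (l - 1) (int (ord a))" using IH(5) a(3) by simp
    \<comment> \<open>By Bezout for l - 1 and the order of a, the element a is a power of c, which
      commutes with t.\<close>
    have ta: "t \<otimes> a = a \<otimes> t"
    proof -
      obtain u v where uv: "u * (l - 1) + v * int (ord a) = 1"
        using cop_l bezout_int[of "l - 1" "int (ord a)"] by (auto simp: coprime_iff_gcd_eq_1)
      have "int (ord a) dvd 1 - (l - 1) * u" using uv by (auto simp: dvd_def algebra_simps intro!: exI[of _ v])
      then have "a = c [^] u" using a(1) int_pow_eq[OF a(1), of "(l - 1) * u" 1] by (simp add: c_def int_pow_pow)
      then show ?thesis using commute_int_pow[OF t(1) c tc, of u] by simp
    qed
    have tal: "t [^] i \<otimes> a [^] l = a [^] l \<otimes> t [^] i"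
      using commute_int_pow[OF t(1) a(1) ta, of l] commute_int_pow[of "a [^] l" t i] t(1) ali by simp
    \<comment> \<open>The order of w divides that of a and is thus coprime to q, so w has no
      component in <t>.\<close>
    have "int q dvd i"
    proof -
      have "w [^] int (ord a) = \<one>"
        using conj_int_pow[OF b(1) a(1), of "int (ord a)"] a(1) b(1) by (simp add: w_def int_pow_int)
      moreover have "w [^] int (ord a) = t [^] (i * int (ord a)) \<otimes> a [^] (l * int (ord a))"
        unfolding wi using int_pow_mult_distrib[OF tal] t(1) a(1) by (simp add: int_pow_pow)
      moreover have "a [^] (l * int (ord a)) = \<one>" using a(1) by (simp add: int_pow_eq_id)
      ultimately have "t [^] (i * int (ord a)) = \<one>" using t(1) by simp
      then have "int q dvd i * int (ord a)" using t by (simp add: int_pow_eq_id)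
      moreover have "coprime (int q) (int (ord a))" using cop(1) a(3) by (simp add: coprime_commute)
      ultimately show ?thesis by (simp add: coprime_dvd_mult_left_iff)
    qed
    then have "t [^] i = \<one>" using t by (simp add: int_pow_eq_id)
    then have "w = a [^] l" using wi ali by simp
    then have ba: "b \<otimes> a = a [^] l \<otimes> b" unfolding w_def using a(1) b(1) by (metis inv_solve_right' int_pow_closed m_closed)
    have ordG: "ord a * ord b * q = order G" using K(4) IH(3) a(3) b(3) by simp
    show ?thesis
    proof (cases "int q dvd \<beta> - 1")
      \<comment> \<open>Here b centralises t, and \<open>b \<otimes> t\<close> acts on a as b
        does.\<close>
      case True
      then have "t [^] \<beta> = t" using int_pow_eq[OF t(1), of \<beta> 1] t by (simp add: dvd_diff_commute)
      then have bt': "b \<otimes> t = t \<otimes> b" using bt by simp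
      have "ord (b \<otimes> t) = ord b * q"
        using ord_mult_coprime[OF bt' b(1) t(1)] cop(2) b(3) t(2) by simp
      then have "ord a * ord (b \<otimes> t) = order G" using ordG by simp
      moreover have "(b \<otimes> t) \<otimes> a = a [^] l \<otimes> (b \<otimes> t)"
      proof -
        have "(b \<otimes> t) \<otimes> a = b \<otimes> a \<otimes> t" using ta a(1) b(1) t(1) by (simp add: m_assoc)
        then show ?thesis using ba a(1) b(1) t(1) by (simp add: m_assoc)
      qed
      ultimately show ?thesis using a(1) b(1) t(1) cop_l
        by (intro exI[of _ a] exI[of _ "b \<otimes> t"] exI[of _ l]) (auto simp: metacyclic_pair_def)
    next
      \<comment> \<open>Here \<beta> - 1 is a unit modulo q, so the invariant on l - 1 survives when
        a is replaced by \<open>a \<otimes> t\<close>; l' combines the two actions by the Chinese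
        remainder theorem.\<close>
      case False
      have cop_aq: "coprime (int (ord a)) (int q)" using cop(1) a(3) by simp
      obtain l' where l': "[l' = l] (mod int (ord a))" "[l' = \<beta>] (mod int q)"
        using binary_chinese_remainder_int[OF cop_aq] by blast
      have "ord (a \<otimes> t) = ord a * q"
        using ord_mult_coprime[OF ta[symmetric] a(1) t(1)] cop(1) a(3) t(2) by simp
      moreover have "b \<otimes> (a \<otimes> t) = (a \<otimes> t) [^] l' \<otimes> b"
      proof -
        have "b \<otimes> (a \<otimes> t) = a [^] l \<otimes> (b \<otimes> t)" using ba a(1) b(1) t(1) by (simp add: m_assoc[symmetric])
        also have "\<dots> = a [^] l \<otimes> t [^] \<beta> \<otimes> b" using bt a(1) b(1) t(1) by (simp add: m_assoc)
        also have "a [^] l = a [^] l'"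
          using l'(1) a(1) by (simp add: int_pow_eq cong_iff_dvd_diff)
        also have "t [^] \<beta> = t [^] l'"
          using l'(2) t by (simp add: int_pow_eq cong_iff_dvd_diff)
        also have "a [^] l' \<otimes> t [^] l' = (a \<otimes> t) [^] l'"
          using int_pow_mult_distrib[OF ta[symmetric] a(1) t(1)] by simp
        finally show ?thesis .
      qed
      moreover have "coprime (l' - 1) (int (ord a * q))"
      proof -
        have "[l' - 1 = l - 1] (mod int (ord a))" using l'(1) by (intro cong_diff) auto
        then have 1: "coprime (l' - 1) (int (ord a))"
          using cop_l cong_imp_coprime cong_sym by blast
        have "[l' - 1 = \<beta> - 1] (mod int q)" using l'(2) by (intro cong_diff) auto
        then have "\<not> int q dvd l' - 1" using False cong_dvd_iff by blast
        then have "coprime (int q) (l' - 1)" using q by (intro prime_imp_coprime) auto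
        then show ?thesis using 1 by (simp add: coprime_commute)
      qed
      ultimately show ?thesis using a(1) b(1) t(1) ordG
        by (intro exI[of _ "a \<otimes> t"] exI[of _ b] exI[of _ l']) (auto simp: metacyclic_pair_def ac_simps)
    qed
  qed
qed

lemma squarefree_metacyclic_pair:
  fixes G :: "'a monoid"
  assumes "group G" "finite (carrier G)" "squarefree (order G)"
  shows "\<exists>a b l. metacyclic_pair G a b l"
  using assms
proof (induction "order G" arbitrary: G rule: less_induct)
  case less
  then show ?case using group.metacyclic_pair_step[of G] by blast
qed


text \<open>In contrast to \<open>metacyclic_pair\<close>, the complement of <a> is split into <b>,
  which acts faithfully on <a>, and <c>, which acts trivially. Each of m, k and z may be 1.\<close>

locale metacyclic_group = group G for G (structure) +
  fixes a b c :: 'a and m k z :: nat and l :: int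
  assumes abc [simp]: "a \<in> carrier G" "b \<in> carrier G" "c \<in> carrier G"
    and ord_abc: "ord a = m" "ord b = k" "ord c = z"
    and order_G: "order G = m * k * z"
    and pos: "m > 0" "k > 0" "z > 0"
    and coprime_orders: "coprime m k" "coprime m z" "coprime k z"
    and ba: "b \<otimes> a = a [^] l \<otimes> b"
    and ca: "c \<otimes> a = a \<otimes> c"
    and cb: "c \<otimes> b = b \<otimes> c"
    and l_faithful: "\<And>j::nat. [l ^ j = 1] (mod int m) \<Longrightarrow> k dvd j"
    and coprime_l: "coprime (l - 1) (int m)"

text \<open>The order k of l modulo m divides the order n of b0, and n = k * z with coprime factors
  by squarefreeness. The cyclic group <b0> is therefore the product of its subgroups of order k and
  z, and the latter is the kernel of the action on <a>.\<close>

lemma squarefree_metacyclic_group: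
  fixes G :: "'a monoid"
  assumes "group G" "finite (carrier G)" "squarefree (order G)"
  shows "\<exists>a b c m k z l. metacyclic_group G a b c m k z l"
proof -
  interpret group G by fact
  obtain a b0 l where "metacyclic_pair G a b0 l"
    using squarefree_metacyclic_pair[OF assms] by blast
  then have ab: "a \<in> carrier G" "b0 \<in> carrier G" and ords: "ord a * ord b0 = order G"
    and ba: "b0 \<otimes>\<^bsub>G\<^esub> a = a [^]\<^bsub>G\<^esub> l \<otimes>\<^bsub>G\<^esub> b0" and cop: "coprime (l - 1) (int (ord a))"
    by (auto simp: metacyclic_pair_def)
  define m n where "m = ord a" and "n = ord b0"
  have n0: "order G > 0" using assms(2) order_gt_0_iff_finite by blast
  have mn: "m > 0" "n > 0" using ords n0 unfolding m_def n_def by (metis nat_0_less_mult_iff)+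
  have cop_mn: "coprime m n" and sqn: "squarefree n"
    using assms(3) unfolding ords[symmetric] m_def n_def
    by (auto intro: squarefree_mult_imp_coprime dest: squarefree_multD)
  have conj: "b0 [^]\<^bsub>G\<^esub> (j::nat) \<otimes>\<^bsub>G\<^esub> a = a [^]\<^bsub>G\<^esub> (l ^ j) \<otimes>\<^bsub>G\<^esub> b0 [^]\<^bsub>G\<^esub> j" for j
    using twist_nat_int_pow[OF ab(2,1) ba, of j 1] ab by simp
  have pow_one: "[l ^ j = 1] (mod int m)" if "b0 [^]\<^bsub>G\<^esub> (j::nat) = \<one>\<^bsub>G\<^esub>" for j
  proof -
    have "a [^]\<^bsub>G\<^esub> (1::int) = a [^]\<^bsub>G\<^esub> (l ^ j)" using conj[of j] that ab by simp
    then show ?thesis using int_pow_eq[OF ab(1)] by (simp add: m_def cong_iff_dvd_diff)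
  qed
  define k where "k = (LEAST j. j > 0 \<and> [l ^ j = 1] (mod int m))"
  have "\<exists>j>0. [l ^ j = 1] (mod int m)" using pow_one[of n] mn ab by (auto simp: n_def)
  then have k: "k > 0" "[l ^ k = 1] (mod int m)"
    and k_le: "\<And>j. j > 0 \<Longrightarrow> [l ^ j = 1] (mod int m) \<Longrightarrow> k \<le> j"
    unfolding k_def by (metis (mono_tags, lifting) LeastI_ex, metis (mono_tags, lifting) LeastI_ex,
      metis (mono_tags, lifting) Least_le)
  have mod_k: "[l ^ j = l ^ (j mod k)] (mod int m)" for j
  proof -
    have "l ^ j = (l ^ k) ^ (j div k) * l ^ (j mod k)"
      by (simp flip: power_mult power_add)
    moreover have "[(l ^ k) ^ (j div k) * l ^ (j mod k) = 1 ^ (j div k) * l ^ (j mod k)] (mod int m)"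
      using k(2) by (intro cong_mult cong_pow) auto
    ultimately show ?thesis by simp
  qed
  have k_dvd: "k dvd j" if "[l ^ j = 1] (mod int m)" for j
  proof -
    have "[l ^ (j mod k) = 1] (mod int m)" using mod_k[of j] that cong_sym cong_trans by blast
    then have "j mod k = 0" using k_le[of "j mod k"] k(1) by (metis mod_less_divisor not_le gr0I)
    then show ?thesis by (simp add: dvd_eq_mod_eq_0)
  qed
  have "k dvd n" using k_dvd pow_one[of n] ab by (simp add: n_def)
  then obtain z where z: "n = k * z" by (elim dvdE)
  have cop_kz: "coprime k z" using sqn unfolding z by (rule squarefree_mult_imp_coprime)
  \<comment> \<open>With e equal to 1 modulo k, the power \<open>b0^e\<close> acts on a exactly as
    b0 does; with e equal to 0 modulo z, its order is reduced to k.\<close>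
  obtain e where e: "[e = 1] (mod k)" "[e = 0] (mod z)"
    using binary_chinese_remainder_nat[OF cop_kz, of 1 0] by blast
  define b where "b = b0 [^]\<^bsub>G\<^esub> e"
  define c where "c = b0 [^]\<^bsub>G\<^esub> k"
  have bc: "b \<in> carrier G" "c \<in> carrier G" using ab by (simp_all add: b_def c_def)
  have "[l ^ e = l ^ 1] (mod int m)"
    using mod_k[of e] mod_k[of 1] e(1) unfolding cong_def[of e] by (metis cong_sym cong_trans)
  then have "a [^]\<^bsub>G\<^esub> (l ^ e) = a [^]\<^bsub>G\<^esub> l"
    using ab by (simp add: int_pow_eq m_def cong_iff_dvd_diff dvd_diff_commute)
  then have ba': "b \<otimes>\<^bsub>G\<^esub> a = a [^]\<^bsub>G\<^esub> l \<otimes>\<^bsub>G\<^esub> b" using conj[of e] by (simp add: b_def)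
  have "a [^]\<^bsub>G\<^esub> (l ^ k) = a [^]\<^bsub>G\<^esub> (1::int)"
    using k(2) ab unfolding int_pow_eq[OF ab(1)] by (simp add: m_def cong_iff_dvd_diff dvd_diff_commute)
  then have ca: "c \<otimes>\<^bsub>G\<^esub> a = a \<otimes>\<^bsub>G\<^esub> c" using conj[of k] ab by (simp add: c_def)
  have cb: "c \<otimes>\<^bsub>G\<^esub> b = b \<otimes>\<^bsub>G\<^esub> c" using ab by (simp add: b_def c_def nat_pow_mult add.commute)
  have "k dvd ord b0" using z n_def by simp
  then have ord_c: "ord c = z" using ord_pow[OF ab(2), of k] k(1) z n_def by (simp add: c_def)
  have ord_b: "ord b = k"
  proof (rule dvd_antisym)
    have "n dvd e * k" using e(2) z by (simp add: cong_0_iff mult.commute mult_dvd_mono)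
    then have "b [^]\<^bsub>G\<^esub> k = \<one>\<^bsub>G\<^esub>" using ab by (simp add: b_def nat_pow_pow pow_eq_id n_def)
    then show "ord b dvd k" using bc pow_eq_id by blast
    have "b0 [^]\<^bsub>G\<^esub> (e * ord b) = \<one>\<^bsub>G\<^esub>"
      using pow_ord_eq_1[OF bc(1)] nat_pow_pow[OF ab(2), of e "ord b"] by (simp add: b_def)
    then have "k dvd e * ord b" by (intro k_dvd pow_one)
    moreover have "coprime k e" using e(1) by (metis cong_imp_coprime cong_sym coprime_1_left coprime_commute)
    ultimately show "k dvd ord b" by (simp add: coprime_dvd_mult_right_iff)
  qed
  have "metacyclic_group G a b c m k z l"
    using ab bc ord_b ord_c ords z mn k cop_mn cop_kz ba' ca cb k_dvd cop
    by unfold_locales (auto simp: m_def n_def)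
  then show ?thesis by blast
qed

section \<open>Automorphisms in normal form\<close>

context metacyclic_group
begin

text \<open>The exponent of b is a natural number because it occurs as the exponent of the integer l
  in \<open>E_mult\<close>; the other two are integers so that they can be negated.\<close>

definition E :: "int \<Rightarrow> nat \<Rightarrow> int \<Rightarrow> 'a" where
  "E i j h = a [^] i \<otimes> b [^] j \<otimes> c [^] h"

lemma E_closed [simp]: "E i j h \<in> carrier G"
  by (simp add: E_def)

lemma c_a_commute: "c [^] (h::int) \<otimes> a [^] (i::int) = a [^] i \<otimes> c [^] h"
proof -
  have "c \<otimes> a [^] i = a [^] i \<otimes> c" using commute_int_pow[OF abc(3,1) ca] .
  then show ?thesis using commute_int_pow[of "a [^] i" c h] by simp
qed

lemma c_b_commute: "c [^] (h::int) \<otimes> b [^] (j::nat) = b [^] j \<otimes> c [^] h"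
proof -
  have "c \<otimes> b [^] int j = b [^] int j \<otimes> c" using commute_int_pow[OF abc(3,2) cb] .
  then show ?thesis using commute_int_pow[of "b [^] j" c h] by (simp add: int_pow_int)
qed

lemma E_mult: "E i j h \<otimes> E i' j' h' = E (i + l ^ j * i') (j + j') (h + h')"
proof -
  have "E i j h \<otimes> E i' j' h' = a [^] i \<otimes> b [^] j \<otimes> (c [^] h \<otimes> a [^] i') \<otimes> b [^] j' \<otimes> c [^] h'"
    by (simp add: E_def m_assoc)
  also have "\<dots> = a [^] i \<otimes> (b [^] j \<otimes> a [^] i') \<otimes> (c [^] h \<otimes> b [^] j') \<otimes> c [^] h'"
    by (simp add: c_a_commute m_assoc)
  also have "\<dots> = (a [^] i \<otimes> a [^] (l ^ j * i')) \<otimes> (b [^] j \<otimes> b [^] j') \<otimes> (c [^] h \<otimes> c [^] h')"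
    by (simp add: twist_nat_int_pow[OF abc(2,1) ba] c_b_commute m_assoc)
  finally show ?thesis by (simp add: E_def int_pow_mult nat_pow_mult)
qed

lemma a_pow_E: "a [^] i = E i 0 0" and b_pow_E: "b [^] j = E 0 j 0" and c_pow_E: "c [^] h = E 0 0 h"
  by (simp_all add: E_def)

lemma one_E: "\<one> = E 0 0 0" by (simp add: E_def)

text \<open>The exponent of a is a sum of terms twisted by powers of l. Order arguments need only
  the other two exponents, so it stays existential.\<close>

lemma E_nat_pow: "\<exists>i'. E i j h [^] (n::nat) = E i' (n * j) (int n * h)"
proof (induction n)
  case (Suc n)
  then obtain i' where "E i j h [^] n = E i' (n * j) (int n * h)" by blast
  then have "E i j h [^] Suc n = E (i' + l ^ (n * j) * i) (Suc n * j) (int (Suc n) * h)"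
    by (simp add: E_mult algebra_simps)
  then show ?case by blast
qed (auto simp: one_E)

lemma l_pow_one_iff: "[l ^ j = 1] (mod int m) \<longleftrightarrow> k dvd j"
proof
  assume "k dvd j"
  then have "b [^] j = \<one>" by (simp add: pow_eq_id ord_abc)
  then have "a [^] (1::int) = a [^] (l ^ j)"
    using twist_nat_int_pow[OF abc(2,1) ba, of j 1] by simp
  then show "[l ^ j = 1] (mod int m)"
    unfolding int_pow_eq[OF abc(1)] by (simp add: ord_abc cong_iff_dvd_diff)
qed (rule l_faithful)

lemma coprime_l_m: "coprime l (int m)"
proof -
  have "coprime (l ^ k) (int m)"
    using l_pow_one_iff[of k] by (metis cong_imp_coprime cong_sym coprime_1_left dvd_refl)
  then show ?thesis using pos by simp
qed

lemma E_eq_one_iff: "E i j h = \<one> \<longleftrightarrow> int m dvd i \<and> k dvd j \<and> int z dvd h"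
proof
  assume "int m dvd i \<and> k dvd j \<and> int z dvd h"
  then have "a [^] i = \<one>" "b [^] j = \<one>" "c [^] h = \<one>"
    by (simp_all add: int_pow_eq_id pow_eq_id ord_abc)
  then show "E i j h = \<one>" by (simp add: E_def)
next
  assume 1: "E i j h = \<one>"
  \<comment> \<open>A trivial element commutes with a, which gives l^j = 1 modulo m, and
    faithfulness of the action removes b.\<close>
  have "E i j h \<otimes> E 1 0 0 = E 1 0 0 \<otimes> E i j h" using 1 by simp
  then have "a [^] (i + l ^ j) \<otimes> (b [^] j \<otimes> c [^] h) = a [^] (1 + i) \<otimes> (b [^] j \<otimes> c [^] h)"
    unfolding E_mult by (simp add: E_def m_assoc)
  then have "a [^] (i + l ^ j) = a [^] (1 + i)" by (simp del: int_pow_mult)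
  then have "[l ^ j = 1] (mod int m)" unfolding int_pow_eq[OF abc(1)]
    by (simp add: ord_abc cong_iff_dvd_diff dvd_diff_commute)
  then have kj: "k dvd j" by (rule l_faithful)
  then have "b [^] j = \<one>" by (simp add: pow_eq_id ord_abc)
  then have ac: "a [^] i \<otimes> c [^] h = \<one>" using 1 by (simp add: E_def)
  \<comment> \<open>What remains is a relation between commuting elements of coprime orders; raising
    it to the order of one isolates the other.\<close>
  have pw: "a [^] (i * n) \<otimes> c [^] (h * n) = \<one>" for n :: int
    using int_pow_mult_distrib[OF c_a_commute[symmetric, of i h], of n] ac by (simp add: int_pow_pow)
  have "c [^] (h * int z) = \<one>" by (simp add: int_pow_eq_id ord_abc)
  then have "a [^] (i * int z) = \<one>" using pw[of "int z"] by simp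
  then have "int m dvd i * int z" by (simp add: int_pow_eq_id ord_abc)
  moreover have "a [^] (i * int m) = \<one>" by (simp add: int_pow_eq_id ord_abc)
  then have "c [^] (h * int m) = \<one>" using pw[of "int m"] by simp
  then have "int z dvd h * int m" by (simp add: int_pow_eq_id ord_abc)
  moreover have "coprime (int m) (int z)" using coprime_orders by simp
  ultimately show "int m dvd i \<and> k dvd j \<and> int z dvd h"
    using kj by (simp add: coprime_dvd_mult_left_iff coprime_commute)
qed

lemma E_eq_iff: "E i j h = E i' j' h' \<longleftrightarrow> [i = i'] (mod int m) \<and> [j = j'] (mod k) \<and> [h = h'] (mod int z)"
proof -
  \<comment> \<open>A natural number that stands in for -j' modulo k.\<close>
  define j2 where "j2 = (k - 1) * j'"
  have j2: "j' + j2 = k * j'" using pos by (simp add: j2_def algebra_simps)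
  have "E i j h = E i' j' h' \<longleftrightarrow> E (- i') 0 0 \<otimes> (E i j h \<otimes> E 0 j2 (- h')) = E (- i') 0 0 \<otimes> (E i' j' h' \<otimes> E 0 j2 (- h'))"
    by (simp del: E_closed add: E_closed)
  also have "\<dots> \<longleftrightarrow> E (i - i') (j + j2) (h - h') = E 0 (k * j') 0"
    by (simp add: E_mult j2)
  also have "E 0 (k * j') 0 = \<one>" by (simp add: E_eq_one_iff)
  also have "k dvd j + j2 \<longleftrightarrow> [j = j'] (mod k)"
  proof -
    have "[j = j'] (mod k) \<longleftrightarrow> [j + j2 = j' + j2] (mod k)" by (rule cong_add_rcancel_nat[symmetric])
    also have "\<dots> \<longleftrightarrow> k dvd j + j2" unfolding j2 by (simp add: cong_def dvd_eq_mod_eq_0)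
    finally show ?thesis by simp
  qed
  then have "(E (i - i') (j + j2) (h - h') = \<one>) = ([i = i'] (mod int m) \<and> [j = j'] (mod k) \<and> [h = h'] (mod int z))"
    by (simp add: E_eq_one_iff cong_iff_dvd_diff)
  finally show ?thesis .
qed

lemma finite_carrier: "finite (carrier G)"
  using order_G pos order_gt_0_iff_finite by simp

lemma E_bij: "bij_betw (\<lambda>(i, j, h). E i j h) ({0..<int m} \<times> {..<k} \<times> {0..<int z}) (carrier G)"
proof -
  have inj: "inj_on (\<lambda>(i, j, h). E i j h) ({0..<int m} \<times> {..<k} \<times> {0..<int z})"
    by (auto intro!: inj_onI simp: E_eq_iff cong_def)
  have "(\<lambda>(i, j, h). E i j h) ` ({0..<int m} \<times> {..<k} \<times> {0..<int z}) = carrier G"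
  proof (rule card_subset_eq[OF finite_carrier])
    show "card ((\<lambda>(i, j, h). E i j h) ` ({0..<int m} \<times> {..<k} \<times> {0..<int z})) = card (carrier G)"
      using card_image[OF inj] order_G by (simp add: order_def card_cartesian_product)
  qed auto
  with inj show ?thesis by (simp add: bij_betw_def)
qed

lemma E_surj:
  assumes "x \<in> carrier G" obtains i j h where "x = E i j h"
proof -
  have "x \<in> (\<lambda>(i, j, h). E i j h) ` ({0..<int m} \<times> {..<k} \<times> {0..<int z})"
    using assms E_bij by (simp add: bij_betw_def)
  then show ?thesis using that by auto
qed

lemma E_inv_0: "inv (E i 0 h) = E (- i) 0 (- h)"
proof -
  have "E (- i) 0 (- h) \<otimes> E i 0 h = \<one>" by (simp add: E_mult one_E)
  then show ?thesis by (intro inv_equality) simp_all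
qed

text \<open>The image of a has order dividing m, and that of c order dividing z; coprimality of the
  three orders kills the other exponents. Stated for endomorphisms, so that it covers an
  automorphism and its inverse.\<close>

lemma hom_generators:
  assumes "\<phi> \<in> hom G G"
  obtains u w where "\<phi> a = E u 0 0" "\<phi> c = E 0 0 w"
proof -
  interpret group_hom G G \<phi> using assms by unfold_locales
  have pow: "\<phi> x [^] n = \<one>" if "x \<in> carrier G" "ord x = n" for x n
    using that hom_nat_pow[of x n] pow_ord_eq_1[of x] by simp
  obtain u j h where u: "\<phi> a = E u j h" using E_surj[of "\<phi> a"] by auto
  obtain u' where "E u j h [^] m = E u' (m * j) (int m * h)" using E_nat_pow by blast
  then have "E u' (m * j) (int m * h) = \<one>" using pow[of a m] u ord_abc by simp
  then have "k dvd m * j" "int z dvd int m * h" by (simp_all add: E_eq_one_iff)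
  moreover have "coprime k m" "coprime (int z) (int m)" using coprime_orders by (simp_all add: coprime_commute)
  ultimately have "k dvd j" "int z dvd h" by (simp_all add: coprime_dvd_mult_right_iff)
  then have 1: "\<phi> a = E u 0 0" unfolding u by (simp add: E_eq_iff cong_0_iff)
  obtain i j w where i: "\<phi> c = E i j w" using E_surj[of "\<phi> c"] by auto
  obtain i' where "E i j w [^] z = E i' (z * j) (int z * w)" using E_nat_pow by blast
  then have "E i' (z * j) (int z * w) = \<one>" using pow[of c z] i ord_abc by simp
  then have "k dvd z * j" by (simp_all add: E_eq_one_iff)
  moreover have "coprime k z" using coprime_orders by simp
  ultimately have "k dvd j" by (simp add: coprime_dvd_mult_right_iff)
  then have i2: "\<phi> c = E i 0 w" unfolding i by (simp add: E_eq_iff cong_0_iff)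
  \<comment> \<open>Without a b-component the powers are not twisted, so the exponent of a can be
    removed in the same way.\<close>
  have "E i 0 w [^] n = E (int n * i) 0 (int n * w)" for n
    by (induction n) (simp_all add: one_E E_mult algebra_simps)
  then have "E (int z * i) 0 (int z * w) = \<one>" using pow[of c z] i2 ord_abc by simp
  then have "int m dvd int z * i" by (simp add: E_eq_one_iff)
  moreover have "coprime (int m) (int z)" using coprime_orders by simp
  ultimately have "int m dvd i" by (simp add: coprime_dvd_mult_right_iff)
  then have "\<phi> c = E 0 0 w" unfolding i2 by (simp add: E_eq_iff cong_0_iff)
  with 1 show ?thesis by (rule that)
qed

text \<open>The exponent of b is preserved because the image of b must again act on <a> as l does.
  The shift is a function \<open>v\<close> of j: it accumulates twisted multiples of
  \<open>v 1\<close>, and no closed form is needed.\<close>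

lemma iso_form:
  assumes iso: "\<phi> \<in> iso G G"
  obtains u w v where "coprime u (int m)" "\<forall>i j h. \<phi> (E i j h) = E (u * i + v j) j (w * h)"
proof -
  have hom: "\<phi> \<in> hom G G" using iso by (simp add: iso_def)
  interpret group_hom G G \<phi> using hom by unfold_locales
  obtain u w where uw: "\<phi> a = E u 0 0" "\<phi> c = E 0 0 w" using hom_generators[OF hom] .
  have pa: "E u 0 0 [^] i = E (u * i) 0 0" and pc: "E 0 0 w [^] i = E 0 0 (w * i)" for i :: int
    by (simp_all flip: a_pow_E c_pow_E add: int_pow_pow)
  \<comment> \<open>Applying the inverse automorphism to a produces an inverse of u modulo
    m.\<close>
  define \<psi> where "\<psi> = inv_into (carrier G) \<phi>"
  have "\<psi> \<in> hom G G" using iso_set_sym[OF iso] by (simp add: \<psi>_def iso_def)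
  then obtain u' w' where psi: "\<psi> a = E u' 0 0" "\<psi> c = E 0 0 w'" using hom_generators by blast
  have "\<phi> (\<psi> a) = a" unfolding \<psi>_def using iso
    by (intro f_inv_into_f) (simp add: iso_def bij_betw_def)
  moreover have "\<phi> (\<psi> a) = E (u * u') 0 0"
    unfolding psi(1) using hom_int_pow[of a u'] uw(1) pa by (simp flip: a_pow_E)
  ultimately have "E (u * u') 0 0 = E 1 0 0" using a_pow_E[of 1] by simp
  then have "[u * u' = 1] (mod int m)" by (simp add: E_eq_iff)
  then have cop: "coprime u (int m)" by (metis coprime_iff_invertible_int)
  obtain v0 j0 h0 where "\<phi> b = E v0 j0 h0" using E_surj[of "\<phi> b"] by auto
  note b0 = this
  obtain i' where "E v0 j0 h0 [^] k = E i' (k * j0) (int k * h0)" using E_nat_pow by blast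
  moreover have "\<phi> b [^] k = \<one>" using hom_nat_pow[of b k] pow_ord_eq_1[of b] ord_abc by simp
  ultimately have "int z dvd int k * h0" using b0 by (simp add: E_eq_one_iff)
  moreover have "coprime (int z) (int k)" using coprime_orders by (simp add: coprime_commute)
  ultimately have "int z dvd h0" by (simp add: coprime_dvd_mult_right_iff)
  then have b1: "\<phi> b = E v0 j0 0" unfolding b0 by (simp add: E_eq_iff cong_0_iff)
  have "\<phi> (b \<otimes> a) = \<phi> (a [^] l \<otimes> b)" using ba by simp
  then have "E v0 j0 0 \<otimes> E u 0 0 = E (u * l) 0 0 \<otimes> E v0 j0 0"
    by (simp add: hom_int_pow uw b1 pa)
  then have "[l ^ j0 * u = l * u] (mod int m)"
    unfolding E_mult E_eq_iff by (simp add: cong_iff_dvd_diff algebra_simps)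
  then have lj: "[l ^ j0 = l] (mod int m)" using cop by (simp add: cong_mult_rcancel)
  \<comment> \<open>Multiplication by l^(k-1), an inverse of l, turns l^j0 = l into a statement to
    which \<open>l_faithful\<close> applies.\<close>
  have "[l ^ (k - 1) * l ^ j0 = l ^ (k - 1) * l] (mod int m)" using lj by (rule cong_scalar_left)
  moreover have "l ^ (k - 1) * l = l ^ k" using pos by (metis Suc_diff_1 power_Suc2)
  ultimately have "[l ^ (k - 1 + j0) = 1] (mod int m)"
    using l_pow_one_iff[of k] by (metis cong_trans dvd_refl power_add)
  then have "k dvd k - 1 + j0" by (rule l_faithful)
  then have "[k - 1 + j0 = k - 1 + 1] (mod k)" using pos by (simp add: cong_def dvd_eq_mod_eq_0)
  then have "[j0 = 1] (mod k)" by (simp only: cong_add_lcancel_nat)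
  then have b2: "\<phi> b = E v0 1 0" unfolding b1 by (simp add: E_eq_iff)
  have "\<exists>v. \<phi> (b [^] j) = E v j 0" for j :: nat
    using hom_nat_pow[of b j] b2 E_nat_pow[of v0 1 0 j] by simp
  then obtain v where v: "\<And>j. \<phi> (b [^] j) = E (v j) j 0" by metis
  have "\<forall>i j h. \<phi> (E i j h) = E (u * i + v j) j (w * h)"
  proof (intro allI)
    fix i j h
    have "\<phi> (E i j h) = E u 0 0 [^] i \<otimes> E (v j) j 0 \<otimes> E 0 0 w [^] h"
      unfolding E_def[of i j h] by (simp add: hom_int_pow uw v)
    then show "\<phi> (E i j h) = E (u * i + v j) j (w * h)" by (simp add: pa pc E_mult)
  qed
  with cop show ?thesis by (rule that)
qed

end

text \<open>Whether x and y are joined depends on \<open>y \<otimes> inv x\<close>. The map f leaves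
  this quotient alone unless exactly one of x and y lies in H. Then the quotient lies outside H and
  is multiplied by a conjugate of t or of its inverse, which is in N and does not affect membership
  in S.\<close>

lemma (in group) not_GRR_if_union_of_cosets:
  assumes N: "N \<lhd> G" and H: "subgroup H G" "N \<subseteq> H" "H \<noteq> carrier G"
    and t: "t \<in> N" "t \<noteq> \<one>" and S: "S \<subseteq> carrier G"
    and cl: "\<And>s n. s \<in> S \<Longrightarrow> s \<notin> H \<Longrightarrow> n \<in> N \<Longrightarrow> s \<otimes> n \<in> S"
  shows "\<not> is_GRR G S"
proof
  assume grr: "is_GRR G S"
  interpret N: normal N G by (rule N)
  interpret H: subgroup H G by (rule H(1))
  have tH: "t \<in> H" and tG: "t \<in> carrier G" using t H(2) by auto
  define f where "f x = (if x \<in> H then x \<otimes> t else x)" for x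
  have fH: "f x \<in> H \<longleftrightarrow> x \<in> H" for x using tH by (simp add: f_def)
  have "bij_betw f (carrier G) (carrier G)"
  proof (rule bij_betw_byWitness[where f' = "\<lambda>x. if x \<in> H then x \<otimes> inv t else x"])
    show "\<forall>x\<in>carrier G. (if f x \<in> H then f x \<otimes> inv t else f x) = x"
      unfolding fH using tG by (auto simp: f_def m_assoc)
    show "\<forall>x\<in>carrier G. f (if x \<in> H then x \<otimes> inv t else x) = x"
      using tG tH by (auto simp: f_def m_assoc)
    show "f ` carrier G \<subseteq> carrier G" using tG by (auto simp: f_def)
    show "(\<lambda>x. if x \<in> H then x \<otimes> inv t else x) ` carrier G \<subseteq> carrier G" using tG by auto
  qed
  have key: "(\<exists>s\<in>S. y = s \<otimes> x) \<longleftrightarrow> y \<otimes> inv x \<in> S" if "x \<in> carrier G" "y \<in> carrier G" for x y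
    using that S by (metis inv_solve_right subsetD)
  have out: "y \<otimes> inv x \<otimes> n \<in> S \<longleftrightarrow> y \<otimes> inv x \<in> S"
    if "x \<in> carrier G" "y \<in> carrier G" "y \<otimes> inv x \<notin> H" "n \<in> N" for x y n
  proof
    have nG: "n \<in> carrier G" and nH: "n \<in> H" using that H(2) by auto
    assume *: "y \<otimes> inv x \<otimes> n \<in> S"
    have "y \<otimes> inv x \<otimes> n \<notin> H"
    proof
      assume "y \<otimes> inv x \<otimes> n \<in> H"
      then have "y \<otimes> inv x \<otimes> n \<otimes> inv n \<in> H" using nH by blast
      then show False using that nG by (simp add: m_assoc)
    qed
    then have "y \<otimes> inv x \<otimes> n \<otimes> inv n \<in> S" using cl * that by blast
    then show "y \<otimes> inv x \<in> S" using that nG by (simp add: m_assoc)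
  qed (use cl that in blast)
  have arc: "cay_arc G S (f x) (f y) \<longleftrightarrow> cay_arc G S x y" if xy: "x \<in> carrier G" "y \<in> carrier G" for x y
  proof -
    have fG: "f x \<in> carrier G" "f y \<in> carrier G" using xy tG by (auto simp: f_def)
    have "f y \<otimes> inv (f x) \<in> S \<longleftrightarrow> y \<otimes> inv x \<in> S"
    proof (cases "x \<in> H"; cases "y \<in> H")
      assume "x \<in> H" "y \<in> H"
      then have "f y \<otimes> inv (f x) = y \<otimes> inv x"
        using xy tG by (simp add: f_def inv_mult_group m_assoc) (simp add: m_assoc[symmetric])
      then show ?thesis by simp
    next
      assume x: "x \<in> H" "y \<notin> H"
      define n where "n = x \<otimes> inv t \<otimes> inv x"
      have n: "n \<in> N" unfolding n_def using N.inv_op_closed2[OF xy(1)] t by blast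
      have "y \<otimes> inv x \<notin> H"
      proof
        assume "y \<otimes> inv x \<in> H"
        then have "y \<otimes> inv x \<otimes> x \<in> H" using x by blast
        then show False using x xy by (simp add: m_assoc)
      qed
      moreover have "f y \<otimes> inv (f x) = y \<otimes> inv x \<otimes> n"
      proof -
        have "inv x \<otimes> n = inv t \<otimes> inv x" unfolding n_def using xy tG by (simp add: m_assoc[symmetric])
        then show ?thesis using x xy tG n by (simp add: f_def inv_mult_group m_assoc)
      qed
      ultimately show ?thesis using out[OF xy _ n] by simp
    next
      assume x: "x \<notin> H" "y \<in> H"
      define n where "n = x \<otimes> t \<otimes> inv x"
      have n: "n \<in> N" unfolding n_def using N.inv_op_closed2[OF xy(1)] t by blast
      have "y \<otimes> inv x \<notin> H"
      proof
        assume "y \<otimes> inv x \<in> H"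
        then have "inv (y \<otimes> inv x) \<otimes> y \<in> H" using x by blast
        then show False using x xy by (simp add: inv_mult_group m_assoc)
      qed
      moreover have "f y \<otimes> inv (f x) = y \<otimes> inv x \<otimes> n"
      proof -
        have "inv x \<otimes> n = t \<otimes> inv x" unfolding n_def using xy tG by (simp add: m_assoc[symmetric])
        then show ?thesis using x xy tG n by (simp add: f_def m_assoc)
      qed
      ultimately show ?thesis using out[OF xy _ n] by simp
    qed (simp add: f_def)
    then show ?thesis using key[OF xy] key[OF fG] xy fG by (simp add: cay_arc_def)
  qed
  have "f \<in> cay_aut G S" unfolding cay_aut_def using \<open>bij_betw f _ _\<close> arc by blast
  then obtain g where g: "g \<in> carrier G" "\<And>x. x \<in> carrier G \<Longrightarrow> f x = x \<otimes> g"
    using grr unfolding is_GRR_def by blast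
  \<comment> \<open>A right multiplication that fixes a point y outside H is the identity, but f
    moves the neutral element to t.\<close>
  obtain y where y: "y \<in> carrier G" "y \<notin> H" using H(3) H.subset by blast
  have "y = y \<otimes> g" using g(2)[OF y(1)] y by (simp add: f_def)
  then have "g = \<one>" using y(1) g(1) by simp
  moreover have "t = g" using g(2)[of \<one>] tG g(1) by (simp add: f_def)
  ultimately show False using t by simp
qed

section \<open>A criterion for not being GRR-detecting\<close>

lemma small_not_dvd: "x \<noteq> 0 \<Longrightarrow> \<bar>x\<bar> < m \<Longrightarrow> \<not> m dvd (x::int)"
  using dvd_imp_le_int[of x m] by linarith

definition in013 :: "int \<Rightarrow> int \<Rightarrow> bool" where
  "in013 m i \<longleftrightarrow> [i = 0] (mod m) \<or> [i = 1] (mod m) \<or> [i = 3] (mod m)"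

lemma in013_cong: "[i = i'] (mod m) \<Longrightarrow> in013 m i \<longleftrightarrow> in013 m i'"
  by (simp add: in013_def cong_def)

text \<open>The restriction on u is essential: modulo 7 the map i -> 2 * i + 1 permutes {0, 1, 3}.
  This is why the sets U below pin u down up to sign first.\<close>

lemma rigid_013:
  assumes m: "m \<ge> 6" and u: "[u = 1] (mod m) \<or> [u = -1] (mod m)"
    and T: "\<And>i. in013 m i \<Longrightarrow> in013 m (u * i + v)"
  shows "[u = 1] (mod m)" "[v = 0] (mod m)"
proof -
  obtain u' where u': "u' = 1 \<or> u' = -1" "[u = u'] (mod m)" using u by blast
  have "in013 m v" using T[of 0] by (simp add: in013_def)
  then obtain v' where v': "v' = 0 \<or> v' = 1 \<or> v' = 3" "[v = v'] (mod m)" unfolding in013_def by blast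
  have T': "in013 m (u' * i + v')" if "in013 m i" for i
    using T[OF that] in013_cong[of "u * i + v" "u' * i + v'"] u'(2) v'(2)
    by (simp add: cong_add cong_scalar_right)
  \<comment> \<open>The images of 1 and 3 rule out five of the six remaining pairs. For the pair
    (-1, 1) the image of 3 is -2, which differs from 3 by 5, so modulus 5 would fail.\<close>
  have "in013 m (u' + v')" "in013 m (u' * 3 + v')" using T'[of 1] T'[of 3] by (simp_all add: in013_def)
  then have "u' = 1 \<and> v' = 0"
    using u'(1) v'(1) m by (auto simp: in013_def cong_iff_dvd_diff small_not_dvd)
  then show "[u = 1] (mod m)" "[v = 0] (mod m)" using u' v' by auto
qed

section \<open>Connection sets given by exponents\<close>

context metacyclic_group
begin

lemma k_gt_1: assumes "m > 1" shows "k > 1"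
proof (rule ccontr)
  assume "\<not> k > 1"
  then have "[l ^ 1 = 1] (mod int m)" using l_pow_one_iff[of 1] pos by auto
  then have "int m dvd l - 1" by (simp add: cong_iff_dvd_diff)
  then have "is_unit (int m)" by (rule coprime_common_divisor[OF coprime_l]) simp
  then show False using assms by simp
qed

lemma E_inv: "inv (E i j h) = E (- (l ^ ((k - 1) * j) * i)) ((k - 1) * j) (- h)"
proof -
  have "(k - 1) * j + j = k * j" using pos by (simp add: algebra_simps)
  then have "E (- (l ^ ((k - 1) * j) * i)) ((k - 1) * j) (- h) \<otimes> E i j h = \<one>"
    by (simp add: E_mult E_eq_one_iff)
  then show ?thesis by (intro inv_equality) simp_all
qed

text \<open>S meets <a, c> in U, which is kept symmetric by hypothesis. In the coset of b^j only T
  is prescribed, and the inverses are adjoined to make S closed under inversion.\<close>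

definition conn_set :: "nat \<Rightarrow> (int \<Rightarrow> int \<Rightarrow> bool) \<Rightarrow> (int \<Rightarrow> int \<Rightarrow> bool) \<Rightarrow> 'a set" where
  "conn_set j U T = {E i 0 h | i h. U i h} \<union> {E i j h | i h. T i h} \<union> {inv (E i j h) | i h. T i h}"

text \<open>Exponents are integers, so this is what makes P a subset of Z/m x Z/z.\<close>

definition cong_invariant :: "(int \<Rightarrow> int \<Rightarrow> bool) \<Rightarrow> bool" where
  "cong_invariant P \<longleftrightarrow> (\<forall>i i' h h'. [i = i'] (mod int m) \<longrightarrow> [h = h'] (mod int z) \<longrightarrow> P i h \<longrightarrow> P i' h')"

lemma conn_set_subset: "conn_set j U T \<subseteq> carrier G"
  by (auto simp: conn_set_def)

lemma conn_set_inv: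
  assumes "\<And>i h. U i h \<Longrightarrow> U (- i) (- h)"
  shows "conn_set j U T = inv_set G (conn_set j U T)"
proof -
  have sub: "inv s \<in> conn_set j U T" if s: "s \<in> conn_set j U T" for s
  proof -
    from s consider i h where "U i h" "s = E i 0 h" | i h where "T i h" "s = E i j h"
      | i h where "T i h" "s = inv (E i j h)" by (auto simp: conn_set_def)
    then show ?thesis
    proof cases
      case 1 then show ?thesis using assms by (auto simp: conn_set_def E_inv_0)
    next
      case 2 then show ?thesis by (auto simp: conn_set_def)
    next
      case 3 then show ?thesis by (auto simp: conn_set_def)
    qed
  qed
  have "s \<in> inv_set G (conn_set j U T)" if "s \<in> conn_set j U T" for s
  proof -
    have "s \<in> carrier G" using that conn_set_subset by blast
    then have "s = inv (inv s)" by simp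
    then show ?thesis unfolding inv_set_def using sub[OF that] by blast
  qed
  then show ?thesis using sub by (auto simp: inv_set_def)
qed

lemma mem_conn_set_0:
  assumes "cong_invariant U" "\<not> k dvd j"
  shows "E i 0 h \<in> conn_set j U T \<longleftrightarrow> U i h"
proof
  assume "E i 0 h \<in> conn_set j U T"
  then consider i' h' where "U i' h'" "E i 0 h = E i' 0 h'" | i' h' where "E i 0 h = E i' j h'"
    | i' h' where "E i 0 h = inv (E i' j h')" by (auto simp: conn_set_def)
  then show "U i h"
  proof cases
    case 1
    then have "[i' = i] (mod int m)" "[h' = h] (mod int z)" by (simp_all add: E_eq_iff cong_sym_eq)
    then show ?thesis using assms(1) 1(1) unfolding cong_invariant_def by blast
  next
    case 2
    then have "[0 = j] (mod k)" by (simp add: E_eq_iff)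
    then have "k dvd j" by (metis cong_0_iff cong_sym)
    then show ?thesis using assms(2) by blast
  next
    case 3
    then have "E i 0 h \<otimes> E i' j h' = \<one>" by simp
    then have "k dvd j" by (simp add: E_mult E_eq_one_iff)
    then show ?thesis using assms(2) by blast
  qed
qed (auto simp: conn_set_def)

text \<open>The danger is k dividing 2 * j, when the adjoined inverses fall into the coset of b^j
  itself. Then l^j = -1 modulo m, so inversion there fixes the exponent of a and negates that of c.
  Symmetry of T in its second argument makes this harmless.\<close>

lemma mem_conn_set_j:
  assumes T: "cong_invariant T" "\<And>i h. T i h \<Longrightarrow> T i (- h)"
    and j: "\<not> k dvd j" "coprime (l ^ j - 1) (int m)"
  shows "E i j h \<in> conn_set j U T \<longleftrightarrow> T i h"
proof
  assume "E i j h \<in> conn_set j U T"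
  then consider i' h' where "E i j h = E i' 0 h'" | i' h' where "T i' h'" "E i j h = E i' j h'"
    | i' h' where "T i' h'" "E i j h = inv (E i' j h')" by (auto simp: conn_set_def)
  then show "T i h"
  proof cases
    case 1
    then have "[j = 0] (mod k)" by (simp add: E_eq_iff)
    then have "k dvd j" by (simp add: cong_0_iff)
    then show ?thesis using j(1) by blast
  next
    case 2
    then have "[i' = i] (mod int m)" "[h' = h] (mod int z)" by (simp_all add: E_eq_iff cong_sym_eq)
    then show ?thesis using T(1) 2(1) unfolding cong_invariant_def by blast
  next
    case 3
    then have "E i j h \<otimes> E i' j h' = \<one>" by simp
    then have *: "int m dvd i + l ^ j * i'" "k dvd j + j" "int z dvd h + h'"
      by (simp_all add: E_mult E_eq_one_iff)
    have "[l ^ (j + j) = 1] (mod int m)" using *(2) by (simp add: l_pow_one_iff)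
    then have "int m dvd (l ^ j - 1) * (l ^ j + 1)"
      by (simp add: cong_iff_dvd_diff power_add algebra_simps)
    then have "int m dvd l ^ j + 1" using j(2) by (simp add: coprime_dvd_mult_right_iff coprime_commute)
    then have "int m dvd (i + l ^ j * i') - (l ^ j + 1) * i'" using *(1) by (intro dvd_diff) auto
    then have "[i' = i] (mod int m)" by (simp add: cong_iff_dvd_diff algebra_simps dvd_diff_commute)
    moreover have "[- h' = h] (mod int z)" using *(3)
      by (metis cong_iff_dvd_diff cong_sym_eq diff_minus_eq_add)
    moreover have "T i' (- h')" using 3(1) T(2) by blast
    ultimately show ?thesis using T(1) unfolding cong_invariant_def by blast
  qed
qed (auto simp: conn_set_def)

lemma iso_id_if_fixes_generators:
  assumes iso: "\<phi> \<in> iso G G" and fixed: "\<phi> a = a" "\<phi> b = b" "\<phi> c = c" and x: "x \<in> carrier G"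
  shows "\<phi> x = x"
proof -
  interpret group_hom G G \<phi> using iso by unfold_locales (simp add: iso_def)
  obtain i j h where "x = E i j h" using E_surj[OF x] .
  then show ?thesis using fixed by (simp add: E_def hom_int_pow hom_nat_pow)
qed

text \<open>Reduces rigidity of S to arithmetic: u and w scale the exponents, and v is the shift on
  the single coset of b^j. Since b^j need not generate <b>, fixing it leaves b itself to be treated
  separately.\<close>

lemma conn_set_aut_stab_trivial:
  assumes U: "cong_invariant U"
    and T: "cong_invariant T" "\<And>i h. T i h \<Longrightarrow> T i (- h)"
    and j: "\<not> k dvd j" "coprime (l ^ j - 1) (int m)"
    and rigid: "\<And>u v w. coprime u (int m) \<Longrightarrow> (\<And>i h. U i h \<Longrightarrow> U (u * i) (w * h)) \<Longrightarrow>
      (\<And>i h. T i h \<longleftrightarrow> T (u * i + v) (w * h)) \<Longrightarrow>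
      [u = 1] (mod int m) \<and> [v = 0] (mod int m) \<and> [w = 1] (mod int z)"
  shows "aut_stab_trivial G (conn_set j U T)"
  unfolding aut_stab_trivial_def
proof (intro ballI impI)
  fix \<phi> x assume iso: "\<phi> \<in> iso G G" and stab: "\<phi> ` conn_set j U T = conn_set j U T" and x: "x \<in> carrier G"
  interpret group_hom G G \<phi> using iso by unfold_locales (simp add: iso_def)
  obtain u w v where cop: "coprime u (int m)" and form': "\<forall>i j h. \<phi> (E i j h) = E (u * i + v j) j (w * h)"
    by (rule iso_form[OF iso]) (rule that)
  then have form: "\<phi> (E i j h) = E (u * i + v j) j (w * h)" for i j h by blast
  have inj: "inj_on \<phi> (carrier G)" using iso by (simp add: iso_def bij_betw_def)
  have mem: "y \<in> conn_set j U T \<longleftrightarrow> \<phi> y \<in> conn_set j U T" if "y \<in> carrier G" for y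
    using inj_on_image_mem_iff[OF inj that conn_set_subset] stab by metis
  have "E (v 0) 0 0 = E 0 0 0" using form[of 0 0 0] hom_one by (simp add: one_E)
  then have v0: "[v 0 = 0] (mod int m)" by (simp add: E_eq_iff)
  have form0: "\<phi> (E i 0 h) = E (u * i) 0 (w * h)" for i h
    unfolding form E_eq_iff using v0 by (simp add: cong_iff_dvd_diff)
  have mem_j: "E i j h \<in> conn_set j U T \<longleftrightarrow> T i h" for i h
    by (rule mem_conn_set_j[OF T(1) _ j]) (rule T(2))
  have "[u = 1] (mod int m) \<and> [v j = 0] (mod int m) \<and> [w = 1] (mod int z)"
  proof (rule rigid[OF cop])
    show "U (u * i) (w * h)" if "U i h" for i h
      using that mem[of "E i 0 h"] unfolding form0 mem_conn_set_0[OF U j(1)] by simp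
    show "T i h \<longleftrightarrow> T (u * i + v j) (w * h)" for i h
      using mem[of "E i j h"] unfolding form mem_j by simp
  qed
  then have uvw: "[u = 1] (mod int m)" "[v j = 0] (mod int m)" "[w = 1] (mod int z)" by simp_all
  have fa: "\<phi> a = a"
  proof -
    have "\<phi> (E 1 0 0) = E 1 0 0" unfolding form0 using uvw(1) by (simp add: E_eq_iff)
    then show ?thesis by (simp add: E_def)
  qed
  have fc: "\<phi> c = c"
  proof -
    have "\<phi> (E 0 0 1) = E 0 0 1" unfolding form0 using uvw(3) by (simp add: E_eq_iff)
    then show ?thesis by (simp add: E_def)
  qed
  (* The image of b commutes with the fixed element b^j, which moves every nontrivial power of a. *)
  have fj: "\<phi> (E 0 j 0) = E 0 j 0" unfolding form using uvw(2) by (simp add: E_eq_iff)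
  have "\<phi> (E 0 1 0 \<otimes> E 0 j 0) = \<phi> (E 0 j 0 \<otimes> E 0 1 0)" by (simp add: E_mult)
  then have "E (v 1) 1 0 \<otimes> E 0 j 0 = E 0 j 0 \<otimes> E (v 1) 1 0" using fj by (simp add: form)
  then have "[v 1 = l ^ j * v 1] (mod int m)" by (simp add: E_mult E_eq_iff)
  then have "int m dvd (l ^ j - 1) * v 1"
    by (simp add: cong_iff_dvd_diff algebra_simps dvd_diff_commute)
  then have "int m dvd v 1" using j(2) by (simp add: coprime_dvd_mult_right_iff coprime_commute)
  then have "\<phi> (E 0 1 0) = E 0 1 0" unfolding form by (simp add: E_eq_iff cong_0_iff)
  then have fb: "\<phi> b = b" by (simp add: E_def)
  show "\<phi> x = x" by (rule iso_id_if_fixes_generators[OF iso fa fb fc x])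
qed

text \<open>\<open>UH\<close> places the part of S without b inside H, so the coset condition
  concerns only T and its inverses; for the inverses it follows from the condition on T by normality
  of N.\<close>

lemma not_GRR_detectingI:
  assumes U: "cong_invariant U" "\<And>i h. U i h \<Longrightarrow> U (- i) (- h)"
    and T: "cong_invariant T" "\<And>i h. T i h \<Longrightarrow> T i (- h)"
    and j: "\<not> k dvd j" "coprime (l ^ j - 1) (int m)"
    and rigid: "\<And>u v w. coprime u (int m) \<Longrightarrow> (\<And>i h. U i h \<Longrightarrow> U (u * i) (w * h)) \<Longrightarrow>
      (\<And>i h. T i h \<longleftrightarrow> T (u * i + v) (w * h)) \<Longrightarrow>
      [u = 1] (mod int m) \<and> [v = 0] (mod int m) \<and> [w = 1] (mod int z)"
    and N: "N \<lhd> G" and H: "subgroup H G" "N \<subseteq> H" "H \<noteq> carrier G" and t: "t \<in> N" "t \<noteq> \<one>"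
    and UH: "\<And>i h. U i h \<Longrightarrow> E i 0 h \<in> H"
    and TN: "\<And>i h n. T i h \<Longrightarrow> E i j h \<notin> H \<Longrightarrow> n \<in> N \<Longrightarrow> \<exists>i' h'. E i j h \<otimes> n = E i' j h' \<and> T i' h'"
  shows "\<not> GRR_detecting G"
proof
  assume det: "GRR_detecting G"
  interpret N: normal N G by (rule N)
  interpret H: subgroup H G by (rule H(1))
  define S where "S = conn_set j U T"
  have "s \<otimes> n \<in> S" if s: "s \<in> S" "s \<notin> H" "n \<in> N" for s n
  proof -
    have nG: "n \<in> carrier G" using s(3) N.subset by blast
    from s consider i h where "T i h" "s = E i j h" | i h where "T i h" "s = inv (E i j h)"
      using UH by (auto simp: S_def conn_set_def)
    then show ?thesis
    proof cases
      case 1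
      then show ?thesis using TN[OF 1(1) _ s(3)] s(2) unfolding S_def conn_set_def by fastforce
    next
      case (2 i h)
      define y where "y = E i j h"
      have yG: "y \<in> carrier G" by (simp add: y_def)
      have "y \<notin> H" using 2 s(2) y_def by blast
      \<comment> \<open>Chosen such that the inverse of \<open>y \<otimes> n'\<close> is
        \<open>inv y \<otimes> n\<close>: this moves a right factor n of an inverse to a right
        factor of y.\<close>
      define n' where "n' = inv y \<otimes> inv n \<otimes> y"
      have "n' \<in> N" unfolding n'_def using N.inv_op_closed1[OF yG] s(3) by blast
      then obtain i' h' where *: "y \<otimes> n' = E i' j h'" "T i' h'"
        using TN[OF 2(1)] \<open>y \<notin> H\<close> unfolding y_def by blast
      have yn: "y \<otimes> n' = inv n \<otimes> y" unfolding n'_def using yG nG by (simp add: m_assoc[symmetric])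
      have "inv (E i' j h') = inv y \<otimes> n"
        unfolding *(1)[symmetric] yn using yG nG by (simp add: inv_mult_group)
      then show ?thesis using *(2) 2 unfolding S_def conn_set_def y_def by auto
    qed
  qed
  then have "\<not> is_GRR G S"
    using not_GRR_if_union_of_cosets[OF N H t conn_set_subset] unfolding S_def by blast
  moreover have "aut_stab_trivial G S"
    unfolding S_def by (rule conn_set_aut_stab_trivial[OF U(1) T j rigid])
  moreover have "S = inv_set G S" unfolding S_def by (rule conn_set_inv) (rule U(2))
  ultimately show False
    using det conn_set_subset[of j U T] unfolding GRR_detecting_def S_def by blast
qed

section \<open>Subgroups in normal form, and groups with nontrivial centre\<close>

lemma coprime_l1: "coprime (l ^ 1 - 1) (int m)" using coprime_l by simp

lemma not_k_dvd_1: "m > 1 \<Longrightarrow> \<not> k dvd 1" using k_gt_1 by simp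

lemma subgroup_E:
  assumes "P 0 0 0" and mult: "\<And>i j h i' j' h'. P i j h \<Longrightarrow> P i' j' h' \<Longrightarrow> P (i + l ^ j * i') (j + j') (h + h')"
    and inv: "\<And>i j h. P i j h \<Longrightarrow> P (- (l ^ ((k - 1) * j) * i)) ((k - 1) * j) (- h)"
  shows "subgroup {E i j h | i j h. P i j h} G"
proof (rule subgroupI)
  show "{E i j h | i j h. P i j h} \<noteq> {}" using assms(1) by blast
  show "inv x \<in> {E i j h | i j h. P i j h}" if "x \<in> {E i j h | i j h. P i j h}" for x
    using that inv by (auto simp: E_inv) blast
  show "x \<otimes> y \<in> {E i j h | i j h. P i j h}"
    if "x \<in> {E i j h | i j h. P i j h}" "y \<in> {E i j h | i j h. P i j h}" for x y
    using that mult by (auto simp: E_mult) blast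
qed auto

lemma normal_a_powers: "{E (int n * i) 0 0 | i. True} \<lhd> G"
proof -
  have "{E (int n * i) 0 0 | i. True} = range (\<lambda>i::int. E (int n) 0 0 [^] i)"
    by (auto simp: int_pow_pow simp flip: a_pow_E)
  moreover have "\<exists>i::int. x \<otimes> E (int n) 0 0 \<otimes> inv x = E (int n) 0 0 [^] i" if x: "x \<in> carrier G" for x
  proof -
    obtain i j h where "x = E i j h" using E_surj[OF x] .
    then have "x \<otimes> E (int n) 0 0 = E (int n * l ^ j) 0 0 \<otimes> x"
      by (simp add: E_mult algebra_simps)
    then have "x \<otimes> E (int n) 0 0 \<otimes> inv x = E (int n * l ^ j) 0 0" using x by (simp add: m_assoc)
    then show ?thesis by (intro exI[of _ "l ^ j"]) (simp add: int_pow_pow flip: a_pow_E)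
  qed
  ultimately show ?thesis using normal_powersI[of "E (int n) 0 0"] by simp
qed

lemma normal_c_powers: "{E 0 0 (int n * h) | h. True} \<lhd> G"
proof -
  have "{E 0 0 (int n * h) | h. True} = range (\<lambda>i::int. E 0 0 (int n) [^] i)"
    by (auto simp: int_pow_pow simp flip: c_pow_E)
  moreover have "\<exists>i::int. x \<otimes> E 0 0 (int n) \<otimes> inv x = E 0 0 (int n) [^] i" if x: "x \<in> carrier G" for x
  proof -
    obtain i j h where "x = E i j h" using E_surj[OF x] .
    then have "x \<otimes> E 0 0 (int n) = E 0 0 (int n) \<otimes> x"
      by (simp add: E_mult add.commute)
    then have "x \<otimes> E 0 0 (int n) \<otimes> inv x = E 0 0 (int n)" using x by (simp add: m_assoc)
    then show ?thesis by (intro exI[of _ 1]) simp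
  qed
  ultimately show ?thesis using normal_powersI[of "E 0 0 (int n)"] by simp
qed

text \<open>Instance with N = <c^n>, H = <a, c> and j = 1. Since N is central, being a union of its
  cosets is just invariance of T in its second argument under adding multiples of n.\<close>

lemma not_GRR_detecting_fiber_c:
  assumes m1: "m > 1"
    and U: "cong_invariant U" "\<And>i h. U i h \<Longrightarrow> U (- i) (- h)"
    and T: "cong_invariant T" "\<And>i h. T i h \<Longrightarrow> T i (- h)"
    and rigid: "\<And>u v w. coprime u (int m) \<Longrightarrow> (\<And>i h. U i h \<Longrightarrow> U (u * i) (w * h)) \<Longrightarrow>
      (\<And>i h. T i h \<longleftrightarrow> T (u * i + v) (w * h)) \<Longrightarrow>
      [u = 1] (mod int m) \<and> [v = 0] (mod int m) \<and> [w = 1] (mod int z)"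
    and n: "\<not> z dvd n" and TN: "\<And>i h x. T i h \<Longrightarrow> T i (h + int n * x)"
  shows "\<not> GRR_detecting G"
proof -
  define H where "H = {E i j h | i j h. k dvd j}"
  show ?thesis
  proof (rule not_GRR_detectingI[where U = U and T = T and j = 1 and H = H and t = "E 0 0 (int n)"])
    show "cong_invariant U" "cong_invariant T" by fact+
    show "U (- i) (- h)" if "U i h" for i h using that by (rule U(2))
    show "T i (- h)" if "T i h" for i h using that by (rule T(2))
    show "\<not> k dvd 1" "coprime (l ^ 1 - 1) (int m)" using not_k_dvd_1[OF m1] coprime_l1 by simp_all
    show "{E 0 0 (int n * h) | h. True} \<lhd> G" by (rule normal_c_powers)
    show "[u = 1] (mod int m) \<and> [v = 0] (mod int m) \<and> [w = 1] (mod int z)"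
      if "coprime u (int m)" "\<And>i h. U i h \<Longrightarrow> U (u * i) (w * h)" "\<And>i h. T i h \<longleftrightarrow> T (u * i + v) (w * h)"
      for u v w using that by (rule rigid)
    show "subgroup H G" unfolding H_def by (rule subgroup_E) auto
    show "{E 0 0 (int n * h) | h. True} \<subseteq> H" by (auto simp: H_def)
    show "H \<noteq> carrier G"
    proof
      assume "H = carrier G"
      then have "E 0 1 0 \<in> H" by simp
      then obtain j where "[1 = j] (mod k)" "k dvd j" by (auto simp: H_def E_eq_iff)
      then show False using not_k_dvd_1[OF m1] by (metis cong_dvd_iff)
    qed
    show "E 0 0 (int n) \<in> {E 0 0 (int n * h) | h. True}" by (auto intro!: exI[of _ 1])
    show "E 0 0 (int n) \<noteq> \<one>" using n by (simp add: E_eq_one_iff)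
    show "E i 0 h \<in> H" for i h by (auto simp: H_def)
    show "\<exists>i' h'. E i 1 h \<otimes> x = E i' 1 h' \<and> T i' h'"
      if "T i h" "x \<in> {E 0 0 (int n * h) | h. True}" for i h x
    proof -
      obtain h' where "x = E 0 0 (int n * h')" using \<open>x \<in> _\<close> by blast
      then show ?thesis using TN[OF \<open>T i h\<close>, of h']
        by (intro exI[of _ i] exI[of _ "h + int n * h'"]) (simp add: E_mult)
    qed
  qed
qed

text \<open>The generator a c of <a, c> and its inverse. A single pair couples u and w: they are
  both 1 or both -1, so fixing the sign of u also fixes w.\<close>

abbreviation "U_diag i h \<equiv> ([i = 1] (mod int m) \<and> [h = 1] (mod int z)) \<or> ([i = -1] (mod int m) \<and> [h = -1] (mod int z))"

lemma U_diag: "cong_invariant U_diag" "U_diag i h \<Longrightarrow> U_diag (- i) (- h)"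
proof -
  show "cong_invariant U_diag" by (simp add: cong_invariant_def cong_def)
  show "U_diag i h \<Longrightarrow> U_diag (- i) (- h)"
    using cong_minus_minus_iff[of i 1 "int m"] cong_minus_minus_iff[of i "-1" "int m"]
      cong_minus_minus_iff[of h 1 "int z"] cong_minus_minus_iff[of h "-1" "int z"] by auto
qed

text \<open>T ignores the exponent of c, hence N can be all of <c>; the set {0, 1, 3} decides the
  common sign left open by \<open>U_diag\<close>.\<close>

lemma not_GRR_detecting_central_large:
  assumes z: "z > 1" and m: "m \<ge> 6"
  shows "\<not> GRR_detecting G"
proof (rule not_GRR_detecting_fiber_c[where n = 1 and U = U_diag and T = "\<lambda>i h. in013 (int m) i"])
  show "cong_invariant U_diag" by (rule U_diag)
  show "U_diag (- i) (- h)" if "U_diag i h" for i h using that by (rule U_diag)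
  show "cong_invariant (\<lambda>i h. in013 (int m) i)" unfolding cong_invariant_def using in013_cong by blast
next
  fix u v w :: int
  assume U: "\<And>i h. U_diag i h \<Longrightarrow> U_diag (u * i) (w * h)"
    and T: "\<And>i (h::int). in013 (int m) i \<longleftrightarrow> in013 (int m) (u * i + v)"
  have uw: "U_diag u w" using U[of 1 1] by simp
  have "[u = 1] (mod int m)" "[v = 0] (mod int m)"
    using rigid_013[of "int m" u v] uw m T by auto
  moreover have "\<not> [1 = -1] (mod int m)" using m small_not_dvd[of 2 "int m"] by (simp add: cong_iff_dvd_diff)
  ultimately show "[u = 1] (mod int m) \<and> [v = 0] (mod int m) \<and> [w = 1] (mod int z)"
    using uw unfolding cong_def by auto
qed (use z m in auto)

text \<open>For m = 3 or 5 the set {0, 1, 3} has symmetries, so the asymmetry is taken from the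
  centre instead. Over the exponents 0 and 1 of a, the set T has the different fibres {0} and {1,
  -1} modulo z2, and N = <c^z2> is nontrivial because z1 > 1.\<close>

lemma not_GRR_detecting_central_composite:
  assumes z: "z = z1 * z2" "z1 > 1" "z2 > 1" and m: "m \<ge> 3"
  shows "\<not> GRR_detecting G"
proof -
  define T where "T i h \<longleftrightarrow> ([i = 0] (mod int m) \<and> [h = 0] (mod int z2)) \<or>
    ([i = 1] (mod int m) \<and> ([h = 1] (mod int z2) \<or> [h = -1] (mod int z2)))" for i h
  have z2: "[h = h'] (mod int z2)" if "[h = h'] (mod int z)" for h h'
    using that by (rule cong_dvd_modulus) (simp add: z(1))
  have not: "\<not> [1 = -1] (mod int m)" using m small_not_dvd[of 2 "int m"] by (simp add: cong_iff_dvd_diff)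
  have not': "\<not> [0 = 1] (mod int z2)" "\<not> [0 = -1] (mod int z2)" "\<not> [0 = 1] (mod int m)" "\<not> [0 = -1] (mod int m)"
    using z(3) m small_not_dvd[of 1 "int z2"] small_not_dvd[of 1 "int m"] by (auto simp: cong_iff_dvd_diff)
  show ?thesis
  proof (rule not_GRR_detecting_fiber_c[where n = z2 and U = U_diag and T = T])
    show "cong_invariant U_diag" by (rule U_diag)
    show "U_diag (- i) (- h)" if "U_diag i h" for i h using that by (rule U_diag)
    show "cong_invariant T" unfolding cong_invariant_def
    proof (intro allI impI)
      fix i i' h h' assume "[i = i'] (mod int m)" "[h = h'] (mod int z)" "T i h"
      then show "T i' h'" using z2[of h h'] by (simp add: T_def cong_def)
    qed
    show "T i (- h)" if "T i h" for i h
      using that cong_minus_minus_iff[of h 0 "int z2"] cong_minus_minus_iff[of h 1 "int z2"]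
        cong_minus_minus_iff[of h "-1" "int z2"] by (auto simp: T_def)
    show "T i (h + int z2 * x)" if "T i h" for i h x
    proof -
      have "[h + int z2 * x = h] (mod int z2)" by (simp add: cong_iff_dvd_diff)
      then show ?thesis using that by (simp add: T_def cong_def)
    qed
    show "\<not> z dvd z2" using z dvd_imp_le[of z z2] by simp
  next
    fix u v w :: int
    assume U: "\<And>i h. U_diag i h \<Longrightarrow> U_diag (u * i) (w * h)"
      and T: "\<And>i h. T i h \<longleftrightarrow> T (u * i + v) (w * h)"
    have uw: "U_diag u w" using U[of 1 1] by simp
    have "T v 0" using T[of 0 0] by (simp add: T_def)
    \<comment> \<open>The fibre over v contains 0 and so cannot be the one over the exponent
      1.\<close>
    then have v: "[v = 0] (mod int m)" using not' by (auto simp: T_def)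
    have "T (u + v) w" using T[of 1 1] by (simp add: T_def)
    then have "[u + v = 0] (mod int m) \<or> [u + v = 1] (mod int m)" by (auto simp: T_def)
    moreover have "[u + v = u + 0] (mod int m)" using v by (intro cong_add) auto
    ultimately have "[u = 0] (mod int m) \<or> [u = 1] (mod int m)" by (simp add: cong_def)
    then show "[u = 1] (mod int m) \<and> [v = 0] (mod int m) \<and> [w = 1] (mod int z)"
      using v uw not not' unfolding cong_def by auto
  qed (use m in auto)
qed

end

section \<open>Groups with trivial centre\<close>

context metacyclic_group
begin

text \<open>N = <a^n> has order q and H = <a^n, b>. Inside H a copy of {0, 1, 3} scaled by n settles
  u and v modulo q; outside H a full coset of N, the exponents that are 1 modulo n, settles u modulo
  n.\<close>

lemma not_GRR_detecting_composite_kernel: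
  assumes z: "z = 1" and m: "m = n * q" "n > 1" "q \<ge> 6" and cop: "coprime n q"
  shows "\<not> GRR_detecting G"
proof -
  define U where "U i (h::int) \<longleftrightarrow> [i = int n] (mod int m) \<or> [i = - int n] (mod int m)" for i h
  define T where "T i (h::int) \<longleftrightarrow> [i = 1] (mod int n) \<or> (\<exists>x. i = int n * x \<and> in013 (int q) x)" for i h
  define H where "H = {E i j h | i j h. int n dvd i}"
  define N where "N = {E (int n * i) 0 0 | i. True}"
  have m': "int m = int n * int q" using m by simp
  have n1: "\<not> int n dvd 1" using m by simp
  have not1: "\<not> [int n * x = 1] (mod int n)" for x
    using n1 cong_dvd_iff[of "int n * x" 1 "int n"] by auto
  have Tn: "T (int n * x) h \<longleftrightarrow> in013 (int q) x" for x h
    using m not1 by (auto simp: T_def)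
  show ?thesis
  proof (rule not_GRR_detectingI[where U = U and T = T and j = 1 and H = H and N = N and t = "E (int n) 0 0"])
    show "cong_invariant U" by (simp add: cong_invariant_def cong_def U_def)
    show "U (- i) (- h)" if "U i h" for i h
      using that cong_minus_minus_iff[of i "int n" "int m"] cong_minus_minus_iff[of i "- int n" "int m"]
      by (auto simp: U_def)
    show "cong_invariant T" unfolding cong_invariant_def
    proof (intro allI impI)
      fix i i' h h' assume *: "[i = i'] (mod int m)" "T i h"
      have "[i = i'] (mod int n)" using *(1) by (rule cong_dvd_modulus) (simp add: m')
      moreover have "T i' h'" if "i = int n * x" "in013 (int q) x" for x
      proof -
        have "int m dvd i' - i" using *(1) by (simp add: cong_iff_dvd_diff dvd_diff_commute)
        then obtain y where "i' - i = int m * y" by (elim dvdE)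
        then have "i' = int n * (x + int q * y)" using that m' by (simp add: algebra_simps)
        moreover have "in013 (int q) (x + int q * y)"
          using that(2) in013_cong[of "x + int q * y" x "int q"] by (simp add: cong_iff_dvd_diff)
        ultimately show ?thesis using Tn by simp
      qed
      ultimately show "T i' h'" using *(2) unfolding T_def by (auto simp: cong_def)
    qed
    show "T i (- h)" if "T i h" for i h using that by (simp add: T_def)
    show "\<not> k dvd 1" using m less_1_mult[of n q] by (intro not_k_dvd_1) simp
    show "coprime (l ^ 1 - 1) (int m)" by (rule coprime_l1)
    show "N \<lhd> G" unfolding N_def by (rule normal_a_powers)
    show "subgroup H G" unfolding H_def by (rule subgroup_E) auto
    have EH: "E i j h \<in> H" if "int n dvd i" for i j h using that unfolding H_def by blast
    show "N \<subseteq> H" by (auto simp: N_def intro: EH)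
    show "H \<noteq> carrier G"
    proof
      assume "H = carrier G"
      then have "E 1 0 0 \<in> H" by simp
      then obtain i where i: "[1 = i] (mod int m)" "int n dvd i" by (auto simp: H_def E_eq_iff)
      have "[1 = i] (mod int n)" using i(1) by (rule cong_dvd_modulus) (simp add: m')
      then show False using i(2) n1 cong_dvd_iff by blast
    qed
    show "E (int n) 0 0 \<in> N" unfolding N_def by (auto intro!: exI[of _ 1])
    have "\<not> m dvd n" using m dvd_imp_le[of m n] by auto
    then show "E (int n) 0 0 \<noteq> \<one>" by (simp add: E_eq_one_iff)
    show "E i 0 h \<in> H" if "U i h" for i h
    proof -
      have "int n dvd int m" by (simp add: m')
      then have "[i = int n] (mod int n) \<or> [i = - int n] (mod int n)"
        using that cong_dvd_modulus[of i _ "int m" "int n"] unfolding U_def by auto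
      then have "int n dvd i"
        using cong_dvd_iff[of i "int n" "int n"] cong_dvd_iff[of i "- int n" "int n"] by auto
      then show ?thesis by (rule EH)
    qed
    show "\<exists>i' h'. E i 1 h \<otimes> x = E i' 1 h' \<and> T i' h'"
      if "T i h" "E i 1 h \<notin> H" "x \<in> N" for i h x
    proof -
      obtain y where y: "x = E (int n * y) 0 0" using \<open>x \<in> N\<close> N_def by auto
      have "\<not> int n dvd i" using \<open>E i 1 h \<notin> H\<close> EH by blast
      then have "[i = 1] (mod int n)" using \<open>T i h\<close> by (auto simp: T_def)
      moreover have "[i + l ^ 1 * (int n * y) = i] (mod int n)" by (simp add: cong_iff_dvd_diff)
      ultimately have "T (i + l ^ 1 * (int n * y)) h" unfolding T_def by (blast intro: cong_trans)
      moreover have "E i 1 h \<otimes> x = E (i + l ^ 1 * (int n * y)) 1 h" unfolding y E_mult by simp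
      ultimately show ?thesis by blast
    qed
    fix u v w :: int
    assume cop_u: "coprime u (int m)" and Uu: "\<And>i h. U i h \<Longrightarrow> U (u * i) (w * h)"
      and Tu: "\<And>i h. T i h \<longleftrightarrow> T (u * i + v) (w * h)"
    have "U (u * int n) (w * 0)" by (rule Uu) (simp add: U_def)
    then have "int n * int q dvd int n * (u - 1) \<or> int n * int q dvd int n * (u + 1)"
      by (simp add: U_def cong_iff_dvd_diff m' algebra_simps)
    then have u: "[u = 1] (mod int q) \<or> [u = -1] (mod int q)"
      using m by (simp add: cong_iff_dvd_diff)
    have T0: "T 0 0" using Tn[of 0 0] by (simp add: in013_def)
    then have Tv: "T v 0" using Tu[of 0 0] by simp
    have "int n dvd v"
    proof (rule ccontr)
      assume "\<not> int n dvd v"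
      then have v1: "[v = 1] (mod int n)" using Tv by (auto simp: T_def)
      \<comment> \<open>If v were in the class of 1 modulo n, every multiple of n would be mapped
        into T. The multiple 2 * n is not in T, as 2 is missing from {0, 1, 3} modulo q.\<close>
      have "[u * (int n * 2) + v = v] (mod int n)" by (simp add: cong_iff_dvd_diff)
      then have "T (u * (int n * 2) + v) (w * 0)" using v1 unfolding T_def by (blast intro: cong_trans)
      then have "in013 (int q) 2" using Tu[of "int n * 2" 0] Tn by simp
      then show False using m by (auto simp: in013_def cong_iff_dvd_diff small_not_dvd)
    qed
    then obtain v' where v': "v = int n * v'" by (elim dvdE)
    have "in013 (int q) (u * x + v')" if "in013 (int q) x" for x
    proof -
      have "T (int n * x) 0" using Tn that by simp
      then have "T (u * (int n * x) + v) (w * 0)" using Tu by blast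
      moreover have "u * (int n * x) + v = int n * (u * x + v')" by (simp add: v' algebra_simps)
      ultimately show ?thesis using Tn by metis
    qed
    then have q: "[u = 1] (mod int q)" "[v' = 0] (mod int q)"
      using rigid_013[of "int q" u v'] u m by auto
    have v0: "[v = 0] (mod int m)" using q(2) by (simp add: cong_0_iff v' m')
    have "T 1 0" by (simp add: T_def)
    then have "T (u + v) (w * 0)" using Tu[of 1 0] by simp
    then have "[u + v = 1] (mod int n) \<or> int n dvd u + v" by (auto simp: T_def)
    \<comment> \<open>A unit u modulo m cannot be divisible by the factor n > 1, so 1 is not mapped
      into the part of T inside H.\<close>
    moreover have "\<not> int n dvd u + v"
    proof
      assume "int n dvd u + v"
      then have "int n dvd u" using v' by (simp add: dvd_add_left_iff)
      then have "is_unit (int n)" by (rule coprime_common_divisor[OF cop_u]) (simp add: m')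
      then show False using n1 by simp
    qed
    moreover have "[u + v = u] (mod int n)" by (simp add: v' cong_iff_dvd_diff)
    ultimately have "[u = 1] (mod int n)" by (auto simp: cong_def)
    then have "[u = 1] (mod int m)" unfolding m' using q(1) cop by (intro coprime_cong_mult) auto
    then show "[u = 1] (mod int m) \<and> [v = 0] (mod int m) \<and> [w = 1] (mod int z)"
      using v0 z by simp
  qed
qed

text \<open>S lies entirely in the proper subgroup H = <a, b^k2>, so the graph is disconnected and N
  = <a> satisfies the coset condition vacuously. An automorphism that fixes a and b^k2 still has to
  fix b, so S can be rigid without generating the group.\<close>

lemma not_GRR_detecting_prime_kernel:
  assumes z: "z = 1" and m: "Factorial_Ring.prime m" "m \<ge> 6" and k: "k = k1 * k2" "k1 > 1" "k2 > 1"
  shows "\<not> GRR_detecting G"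
proof -
  define U where "U i (h::int) \<longleftrightarrow> [i = 1] (mod int m) \<or> [i = - 1] (mod int m)" for i h
  define T where "T i (h::int) \<longleftrightarrow> in013 (int m) i" for i h
  define H where "H = {E i j h | i j h. k2 dvd j}"
  define N where "N = {E (int 1 * i) 0 0 | i. True}"
  have kk2: "\<not> k dvd k2" using k dvd_imp_le[of k k2] by auto
  show ?thesis
  proof (rule not_GRR_detectingI[where U = U and T = T and j = k2 and H = H and N = N and t = "E 1 0 0"])
    show "cong_invariant U" by (simp add: cong_invariant_def cong_def U_def)
    show "U (- i) (- h)" if "U i h" for i h
      using that cong_minus_minus_iff[of i 1 "int m"] cong_minus_minus_iff[of i "- 1" "int m"]
      by (auto simp: U_def)
    show "cong_invariant T" unfolding cong_invariant_def T_def using in013_cong by simp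
    show "T i (- h)" if "T i h" for i h using that by (simp add: T_def)
    show "\<not> k dvd k2" by (rule kk2)
    \<comment> \<open>Primality of m turns the nontrivial action of b^k2 on <a> into one whose
      difference l^k2 - 1 is a unit.\<close>
    have "\<not> int m dvd l ^ k2 - 1" using kk2 l_pow_one_iff by (simp add: cong_iff_dvd_diff)
    then have "coprime (int m) (l ^ k2 - 1)" using m(1) by (intro prime_imp_coprime) auto
    then show "coprime (l ^ k2 - 1) (int m)" by (simp add: coprime_commute)
    show "N \<lhd> G" unfolding N_def by (rule normal_a_powers)
    show "subgroup H G" unfolding H_def by (rule subgroup_E) auto
    have EH: "E i j h \<in> H" if "k2 dvd j" for i j h using that unfolding H_def by blast
    show "N \<subseteq> H" by (auto simp: N_def intro: EH)
    show "H \<noteq> carrier G"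
    proof
      assume "H = carrier G"
      then have "E 0 1 0 \<in> H" by simp
      then obtain j where j: "[1 = j] (mod k)" "k2 dvd j" by (auto simp: H_def E_eq_iff)
      have "[1 = j] (mod k2)" using j(1) by (rule cong_dvd_modulus_nat) (simp add: k(1))
      then have "k2 dvd 1" using j(2) cong_dvd_iff by blast
      then show False using k by simp
    qed
    show "E 1 0 0 \<in> N" unfolding N_def by (auto intro!: exI[of _ 1])
    show "E 1 0 0 \<noteq> \<one>" using m by (simp add: E_eq_one_iff)
    show "E i 0 h \<in> H" for i h by (rule EH) simp
    show "\<exists>i' h'. E i k2 h \<otimes> x = E i' k2 h' \<and> T i' h'" if "E i k2 h \<notin> H" for i h x
      using that EH[OF dvd_refl] by simp
    fix u v w :: int
    assume Uu: "\<And>i h. U i h \<Longrightarrow> U (u * i) (w * h)" and Tu: "\<And>i h. T i h \<longleftrightarrow> T (u * i + v) (w * h)"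
    have "U (u * 1) (w * 1)" by (rule Uu) (simp add: U_def)
    then have "[u = 1] (mod int m) \<or> [u = - 1] (mod int m)" by (simp add: U_def)
    then have "[u = 1] (mod int m)" "[v = 0] (mod int m)"
      using rigid_013[of "int m" u v] m(2) Tu unfolding T_def by auto
    then show "[u = 1] (mod int m) \<and> [v = 0] (mod int m) \<and> [w = 1] (mod int z)" using z by simp
  qed
qed

end

section \<open>Recognising the excluded groups\<close>

lemma composite_natE:
  assumes "1 < n" "\<not> Factorial_Ring.prime (n::nat)"
  obtains x y where "n = x * y" "1 < x" "1 < y"
proof -
  obtain x where x: "x dvd n" "x \<noteq> 1" "x \<noteq> n" using assms unfolding prime_nat_iff by blast
  then obtain y where y: "n = x * y" by (elim dvdE)
  have "x \<noteq> 0" "y \<noteq> 0" using y assms(1) by (auto intro: gr0I)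
  moreover have "y \<noteq> 1" using y x(3) by auto
  ultimately have "1 < x" "1 < y" using x(2) by linarith+
  with y show ?thesis by (rule that)
qed

text \<open>The natural map runs from the concrete model D to G. Asking only for closure of D avoids
  checking the group axioms of the model.\<close>

lemma is_isoI_reverse:
  assumes bij: "bij_betw f (carrier D) (carrier G)"
    and closed: "\<And>x y. x \<in> carrier D \<Longrightarrow> y \<in> carrier D \<Longrightarrow> x \<otimes>\<^bsub>D\<^esub> y \<in> carrier D"
    and hom: "\<And>x y. x \<in> carrier D \<Longrightarrow> y \<in> carrier D \<Longrightarrow> f (x \<otimes>\<^bsub>D\<^esub> y) = f x \<otimes>\<^bsub>G\<^esub> f y"
  shows "G \<cong> D"
proof -
  define g where "g = inv_into (carrier D) f"
  have g: "bij_betw g (carrier G) (carrier D)" unfolding g_def by (rule bij_betw_inv_into[OF bij])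
  have gD: "g x \<in> carrier D" if "x \<in> carrier G" for x using g that by (auto simp: bij_betw_def)
  have fg: "f (g x) = x" if "x \<in> carrier G" for x
    unfolding g_def using bij_betw_inv_into_right[OF bij that] .
  have gf: "g (f x) = x" if "x \<in> carrier D" for x
    unfolding g_def using bij_betw_inv_into_left[OF bij that] .
  have "g (x \<otimes>\<^bsub>G\<^esub> y) = g x \<otimes>\<^bsub>D\<^esub> g y" if "x \<in> carrier G" "y \<in> carrier G" for x y
    using hom[OF gD gD] fg gf[OF closed[OF gD gD]] that by metis
  then have "g \<in> iso G D" using g gD by (auto simp: iso_def hom_def)
  then show ?thesis by (auto simp: is_iso_def)
qed

context metacyclic_group
begin

text \<open>For k = 2, m divides (l - 1) * (l + 1) and l - 1 is a unit, so l = -1 modulo m: b acts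
  by inversion.\<close>

lemma E_dihedral_mult:
  assumes k: "k = 2" and e: "e \<in> {0..<2}" "f \<in> {0..<2::int}"
  shows "E i (nat e) h \<otimes> E i' (nat f) h' =
    E ((i + (if e = 0 then i' else - i')) mod int m) (nat ((e + f) mod 2)) ((h + h') mod int z)"
proof -
  have "[l ^ 2 = 1] (mod int m)" using l_pow_one_iff[of 2] k by simp
  then have "int m dvd (l - 1) * (l + 1)" by (simp add: cong_iff_dvd_diff power2_eq_square algebra_simps)
  then have l: "int m dvd l + 1" using coprime_l by (simp add: coprime_dvd_mult_right_iff coprime_commute)
  have e': "e = 0 \<or> e = 1" "f = 0 \<or> f = 1" using e by auto
  have "[i + l ^ nat e * i' = i + (if e = 0 then i' else - i')] (mod int m)"
  proof (cases "e = 0")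
    case False
    have "int m dvd (l + 1) * i'" using l by simp
    moreover have "(l + 1) * i' = i + l * i' - (i + - i')" by (simp add: algebra_simps)
    ultimately show ?thesis using False e' by (simp add: cong_iff_dvd_diff)
  qed simp
  moreover have "[nat e + nat f = nat ((e + f) mod 2)] (mod k)" using e' k by (auto simp: cong_def)
  ultimately show ?thesis by (simp add: E_mult E_eq_iff cong_def)
qed

lemma bij_betw_carrierI:
  assumes "inj_on g A" "\<And>x. x \<in> A \<Longrightarrow> g x \<in> carrier G" "card A = order G"
  shows "bij_betw g A (carrier G)"
proof -
  have "g ` A = carrier G" using assms
    by (intro card_subset_eq[OF finite_carrier]) (auto simp: card_image order_def)
  then show ?thesis using assms(1) by (simp add: bij_betw_def)
qed

lemma nat_2_cong: "e \<in> {0..<2} \<Longrightarrow> f \<in> {0..<2::int} \<Longrightarrow> [nat e = nat f] (mod 2) \<longleftrightarrow> e = f"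
  by (auto simp: cong_def)

lemma iso_dihedral_times_cyclic:
  assumes k: "k = 2"
  shows "G \<cong> DirProd (dihedral_group m) (integer_mod_group z)"
proof (rule is_isoI_reverse)
  define f where "f = (\<lambda>((i, e), h). E i (nat e) h)"
  let ?D = "DirProd (dihedral_group m) (integer_mod_group z)"
  have car: "carrier ?D = ({0..<int m} \<times> {0..<2}) \<times> {0..<int z}"
    using pos by (simp add: dihedral_group_def carrier_integer_mod_group)
  show "bij_betw f (carrier ?D) (carrier G)"
  proof (rule bij_betw_carrierI)
    show "inj_on f (carrier ?D)" unfolding car
      by (rule inj_onI) (auto simp: f_def E_eq_iff k nat_2_cong cong_def)
    show "f x \<in> carrier G" for x by (auto simp: f_def split: prod.split)
    show "card (carrier ?D) = order G" unfolding car order_G k by (simp add: card_cartesian_product)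
  qed
  fix x y assume xy: "x \<in> carrier ?D" "y \<in> carrier ?D"
  show "x \<otimes>\<^bsub>?D\<^esub> y \<in> carrier ?D" using xy pos unfolding car by (auto simp: dihedral_group_def)
  obtain i e h i' e' h' where x: "x = ((i, e), h)" and y: "y = ((i', e'), h')"
    by (metis surj_pair)
  have "e \<in> {0..<2}" "e' \<in> {0..<2}" using xy unfolding car x y by auto
  then show "f (x \<otimes>\<^bsub>?D\<^esub> y) = f x \<otimes> f y"
    by (simp add: x y f_def dihedral_group_def E_dihedral_mult[OF k])
qed

lemma iso_dihedral:
  assumes k: "k = 2" and z: "z = 1"
  shows "G \<cong> dihedral_group m"
proof (rule is_isoI_reverse)
  define f where "f = (\<lambda>(i, e). E i (nat e) 0)"
  let ?D = "dihedral_group m"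
  have car: "carrier ?D = {0..<int m} \<times> {0..<2}" by (simp add: dihedral_group_def)
  show "bij_betw f (carrier ?D) (carrier G)"
  proof (rule bij_betw_carrierI)
    show "inj_on f (carrier ?D)" unfolding car
      by (rule inj_onI) (auto simp: f_def E_eq_iff k nat_2_cong cong_def)
    show "f x \<in> carrier G" for x by (auto simp: f_def split: prod.split)
    show "card (carrier ?D) = order G" unfolding car order_G k z by (simp add: card_cartesian_product)
  qed
  fix x y assume xy: "x \<in> carrier ?D" "y \<in> carrier ?D"
  show "x \<otimes>\<^bsub>?D\<^esub> y \<in> carrier ?D" using xy pos unfolding car by (auto simp: dihedral_group_def)
  obtain i e i' e' where x: "x = (i, e)" and y: "y = (i', e')" by (metis surj_pair)
  have "e \<in> {0..<2}" "e' \<in> {0..<2}" using xy unfolding car x y by auto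
  then show "f (x \<otimes>\<^bsub>?D\<^esub> y) = f x \<otimes> f y"
    by (simp add: x y f_def dihedral_group_def E_dihedral_mult[OF k])
qed

lemma semidirect_cyclic:
  assumes z: "z = 1"
  shows "is_semidirect_Cq_Cp G m k"
proof -
  define N where "N = {E (int 1 * i) 0 0 | i. True}"
  define H where "H = {E i j h | i j h. i = 0}"
  have N: "N \<lhd> G" unfolding N_def by (rule normal_a_powers)
  have H: "subgroup H G" unfolding H_def by (rule subgroup_E) auto
  have E_h: "E i j h = E i j 0" for i j h using z by (simp add: E_eq_iff)
  have "N \<inter> H = {\<one>}"
  proof
    show "N \<inter> H \<subseteq> {\<one>}"
    proof
      fix x assume "x \<in> N \<inter> H"
      then obtain i where "x = E i 0 0" by (auto simp: N_def)
      moreover obtain j h where "x = E 0 j h" using \<open>x \<in> N \<inter> H\<close> by (auto simp: H_def)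
      ultimately have "E i 0 0 = E 0 j h" by simp
      then have "int m dvd i" by (simp add: E_eq_iff cong_0_iff)
      then show "x \<in> {\<one>}" using \<open>x = E i 0 0\<close> by (simp add: E_eq_one_iff)
    qed
    show "{\<one>} \<subseteq> N \<inter> H"
      using subgroup.one_closed[OF H] subgroup.one_closed[OF normal_imp_subgroup[OF N]] by simp
  qed
  moreover have "N <#> H = carrier G"
  proof
    show "N <#> H \<subseteq> carrier G"
      using subgroup.subset[OF H] subgroup.subset[OF normal_imp_subgroup[OF N]] by (rule setmult_subset_G[rotated])
    show "carrier G \<subseteq> N <#> H"
    proof
      fix x assume "x \<in> carrier G"
      then obtain i j h where "x = E i j h" by (rule E_surj)
      then have "x = E (int 1 * i) 0 0 \<otimes> E 0 j h" by (simp add: E_mult)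
      moreover have "E (int 1 * i) 0 0 \<in> N" "E 0 j h \<in> H" unfolding N_def H_def by blast+
      ultimately show "x \<in> N <#> H" by (auto simp: set_mult_def)
    qed
  qed
  moreover have "G\<lparr>carrier := N\<rparr> \<cong> integer_mod_group m"
  proof (rule is_isoI_reverse)
    show "bij_betw (\<lambda>i. E i 0 0) (carrier (integer_mod_group m)) (carrier (G\<lparr>carrier := N\<rparr>))"
    proof (rule bij_betw_imageI)
      show "inj_on (\<lambda>i. E i 0 0) (carrier (integer_mod_group m))"
        using pos by (auto intro!: inj_onI simp: carrier_integer_mod_group E_eq_iff cong_def)
      have "E i 0 0 \<in> (\<lambda>i. E i 0 0) ` {0..<int m}" for i
        using pos by (intro image_eqI[of _ _ "i mod int m"]) (simp_all add: E_eq_iff)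
      then show "(\<lambda>i. E i 0 0) ` carrier (integer_mod_group m) = carrier (G\<lparr>carrier := N\<rparr>)"
        using pos by (auto simp: carrier_integer_mod_group N_def)
    qed
  qed (use pos in \<open>auto simp: carrier_integer_mod_group E_mult E_eq_iff\<close>)
  moreover have "G\<lparr>carrier := H\<rparr> \<cong> integer_mod_group k"
  proof (rule is_isoI_reverse)
    show "bij_betw (\<lambda>j. E 0 (nat j) 0) (carrier (integer_mod_group k)) (carrier (G\<lparr>carrier := H\<rparr>))"
    proof (rule bij_betw_imageI)
      show "inj_on (\<lambda>j. E 0 (nat j) 0) (carrier (integer_mod_group k))"
        using pos by (auto intro!: inj_onI simp: carrier_integer_mod_group E_eq_iff cong_def nat_less_iff)
      have "E 0 j h \<in> (\<lambda>j. E 0 (nat j) 0) ` {0..<int k}" for j h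
        unfolding E_h[of 0 j h] using pos
        by (intro image_eqI[of _ _ "int (j mod k)"]) (simp_all add: E_eq_iff)
      then show "(\<lambda>j. E 0 (nat j) 0) ` carrier (integer_mod_group k) = carrier (G\<lparr>carrier := H\<rparr>)"
        using pos by (auto simp: carrier_integer_mod_group H_def)
    qed
    fix x y assume xy: "x \<in> carrier (integer_mod_group k)" "y \<in> carrier (integer_mod_group k)"
    then have "0 \<le> x" "0 \<le> y" using pos by (auto simp: carrier_integer_mod_group)
    then have "nat ((x + y) mod int k) = (nat x + nat y) mod k"
      by (simp add: nat_mod_distrib nat_add_distrib)
    then show "E 0 (nat (x \<otimes>\<^bsub>integer_mod_group k\<^esub> y)) 0 =
        E 0 (nat x) 0 \<otimes>\<^bsub>G\<lparr>carrier := H\<rparr>\<^esub> E 0 (nat y) 0"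
      by (simp add: E_mult E_eq_iff)
  qed (use pos in \<open>auto simp: carrier_integer_mod_group\<close>)
  ultimately show ?thesis unfolding is_semidirect_Cq_Cp_def using N H by blast
qed

lemma m_eq_1_imp_comm:
  assumes "m = 1" shows "comm_group G"
proof (rule group_comm_groupI)
  fix x y assume "x \<in> carrier G" "y \<in> carrier G"
  then obtain i j h i' j' h' where "x = E i j h" "y = E i' j' h'" by (metis E_surj)
  then show "x \<otimes> y = y \<otimes> x" using assms by (simp add: E_mult E_eq_iff add.commute)
qed

text \<open>Both l and l - 1 are units modulo m, and one of two consecutive integers is
  even.\<close>

lemma odd_m: "odd m"
proof
  assume "even m"
  then have "even (int m)" by simp
  then have "odd l" "odd (l - 1)"
    using coprime_common_divisor[of l "int m" 2] coprime_common_divisor[of "l - 1" "int m" 2]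
      coprime_l_m coprime_l by auto
  then show False by simp
qed

text \<open>Units modulo 3 and modulo 5, hence modulo 15, have order dividing 4, so k divides 4;
  being squarefree and larger than 1 it is 2.\<close>

lemma k_eq_2:
  assumes m: "m \<in> {3, 5, 15}" and sq: "squarefree k"
  shows "k = 2"
proof -
  have l4: "[l ^ 4 = 1] (mod p)" if "p = 3 \<or> p = 5" "coprime l p" for p :: int
  proof -
    have "\<not> p dvd l" using that coprime_common_divisor[of l p p] by auto
    then have "l mod p \<noteq> 0" by (simp add: dvd_eq_mod_eq_0)
    moreover have "l mod p \<ge> 0" "l mod p < p" using that by auto
    ultimately have "l mod p \<in> {1, 2} \<and> p = 3 \<or> l mod p \<in> {1, 2, 3, 4} \<and> p = 5" using that by auto
    then have "(l mod p) ^ 4 mod p = 1 mod p" by auto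
    then show ?thesis by (simp add: cong_def power_mod)
  qed
  have "[l ^ 4 = 1] (mod int m)"
  proof (cases "m = 15")
    case True
    have "coprime l (3 * 5)" using coprime_l_m True by simp
    then have "coprime l 3" "coprime l 5" by (simp_all only: coprime_mult_right_iff)
    moreover have "coprime (3 :: int) 5"
    proof (rule coprimeI)
      fix d :: int assume "d dvd 3" "d dvd 5"
      then have "d dvd 2 * 3 - 5" by (intro dvd_diff dvd_mult)
      then show "is_unit d" by simp
    qed
    ultimately have "[l ^ 4 = 1] (mod 3 * 5)" using l4 by (intro coprime_cong_mult) auto
    then show ?thesis using True by simp
  next
    case False
    then show ?thesis using l4[of "int m"] coprime_l_m m by auto
  qed
  then have k4: "k dvd 4" by (rule l_faithful)
  have "k \<noteq> 4" using squarefreeD[OF sq, of 2] by auto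
  moreover have "k > 1" using m by (intro k_gt_1) auto
  moreover have "k \<le> 4" using k4 by (simp add: dvd_imp_le)
  moreover have "k \<noteq> 3" using k4 by auto
  ultimately show ?thesis by linarith
qed

end

theorem theorem3p3:
  fixes R :: "'a monoid"
  assumes "group R"
    and "finite (carrier R)"
    and "squarefree (order R)"
    and "\<not> comm_group R"
    and "\<not> R \<cong> dihedral_group 3"
    and "\<not> R \<cong> dihedral_group 5"
    and "\<not> R \<cong> dihedral_group 15"
    and "\<And>q. Factorial_Ring.prime (q::nat) \<Longrightarrow> \<not> R \<cong> DirProd (dihedral_group 3) (cyclic_group q)"
    and "\<And>q. Factorial_Ring.prime (q::nat) \<Longrightarrow> \<not> R \<cong> DirProd (dihedral_group 5) (cyclic_group q)"
    and "\<And>q p. Factorial_Ring.prime (q::nat) \<Longrightarrow> Factorial_Ring.prime (p::nat) \<Longrightarrow> \<not> is_semidirect_Cq_Cp R q p"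
  shows "\<not> GRR_detecting R"
proof -
  obtain a b c m k z l where "metacyclic_group R a b c m k z l"
    using squarefree_metacyclic_group[OF assms(1-3)] by blast
  then interpret metacyclic_group R a b c m k z l .
  have sq: "squarefree m" "squarefree k"
    using assms(3) order_G squarefree_multD by metis+
  have "m \<noteq> 1" using m_eq_1_imp_comm assms(4) by blast
  then have m3: "m \<ge> 3" using odd_m pos by (cases "m = 2") auto
  have m35: "m = 3 \<or> m = 5" if "m < 6"
  proof -
    have "m \<noteq> 4" using odd_m by auto
    then show ?thesis using that m3 by linarith
  qed
  have k1: "k > 1" using m3 by (intro k_gt_1) simp
  show ?thesis
  proof (cases "z = 1")
    case False
    then have z1: "z > 1" using pos by simp
    show ?thesis
    proof (cases "m \<ge> 6")
      case True
      then show ?thesis using not_GRR_detecting_central_large z1 by blast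
    next
      case False
      then have m: "m = 3 \<or> m = 5" using m35 by simp
      then have "k = 2" using k_eq_2 sq by blast
      then have iso: "R \<cong> DirProd (dihedral_group m) (integer_mod_group z)" by (rule iso_dihedral_times_cyclic)
      \<comment> \<open>A prime z would give one of the excluded direct products, so the centre has
        the room that a small m denies.\<close>
      then have "\<not> Factorial_Ring.prime z" using assms(8,9) m by blast
      then obtain z1 z2 where "z = z1 * z2" "1 < z1" "1 < z2"
        using composite_natE[OF z1] by metis
      then show ?thesis using not_GRR_detecting_central_composite m3 by blast
    qed
  next
    case z: True
    show ?thesis
    proof (cases "Factorial_Ring.prime m")
      case True
      then have np: "\<not> Factorial_Ring.prime k" using semidirect_cyclic[OF z] assms(10) by blast
      have "m \<ge> 6"
      proof (rule ccontr)
        assume "\<not> m \<ge> 6"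
        then have "k = 2" using m35 k_eq_2 sq by auto
        then show False using np by simp
      qed
      moreover obtain k1 k2 where "k = k1 * k2" "1 < k1" "1 < k2"
        using composite_natE[OF k1 np] by metis
      ultimately show ?thesis using not_GRR_detecting_prime_kernel[OF z True] by blast
    next
      case False
      then obtain n q where nq: "m = n * q" "1 < n" "1 < q"
        using composite_natE[of m] m3 by auto
      have cop: "coprime n q" using sq(1) nq(1) squarefree_mult_imp_coprime by blast
      show ?thesis
      proof (cases "n \<ge> 6 \<or> q \<ge> 6")
        case True
        then show ?thesis
          using not_GRR_detecting_composite_kernel[OF z, of n q] not_GRR_detecting_composite_kernel[OF z, of q n]
            nq cop by (auto simp: coprime_commute mult.commute)
      next
        case False
        \<comment> \<open>Odd factors below 6 are 3 or 5, and coprimality leaves 3 * 5.\<close>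
        have "odd n" "odd q" using odd_m nq(1) by auto
        then have "n \<noteq> 2" "n \<noteq> 4" "q \<noteq> 2" "q \<noteq> 4" by auto
        then have "n = 3 \<or> n = 5" "q = 3 \<or> q = 5" using False nq by linarith+
        then have m15: "m = 15" using cop nq(1) by auto
        then have "k = 2" using k_eq_2 sq by blast
        then have "R \<cong> dihedral_group 15" using iso_dihedral z m15 by blast
        then show ?thesis using assms(7) by blast
      qed
    qed
  qed
qed

end
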